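(* For $n>0$, the map $\widetilde\Gamma$ (described in the context) is a bijection from (a) the set of triples $(\mu,\mu_{\mathrm{steep}},P)$ such that $\mu$ is a Dyck path with $2n$ steps and $P$ is a vertical labeling of $\mu$, to (b) the set of triples $(\nu_{\mathrm{bounce}},\nu,Q)$ such that $\nu$ is a Dyck path with $2n$ steps and $Q$ is a diagonal labeling of $\nu$. Moreover, if $(\nu_{\mathrm{bounce}},\nu,Q)=\widetilde\Gamma(\mu,\mu_{\mathrm{steep}},P)$, then $(\nu,Q)=\widetilde\zeta(\mu,P)$, where $\widetilde\zeta$ is the Haglund--Loehr zeta map from parking functions to diagonally labeled Dyck paths.
   Context: Dyck paths. A Dyck path with $2n$ steps is a lattice path from $(0,0)$ to $(n,n)$ with steps $N=(0,1)$, $E=(1,0)$ staying weakly above the main diagonal. A valley is a lattice point on the path preceded by $E$ and followed by $N$. Steep and bounce path of a Dyck path $\mu$. $\mu_{\mathrm{steep}}$: start at the origin; move north (by at least one step) until the first point at which an east-step can be added while remaining weakly above $\mu$; append this east-step; repeat until a point with $y$-coordinate $n$ is reached; then add east-steps to end at $(n,n)$. $\mu_{\mathrm{bounce}}$: start at the origin; move north to the last point that is still weakly below $\mu$; move east until the main diagonal is hit; repeat until $(n,n)$ is reached. The bounce parameters of $\mu$ are the $x$-coordinates $0=b_0<\dots<b_r=n$ of the contact points of $\mu_{\mathrm{bounce}}$ with the main diagonal. Labelings. A vertical labeling of $\mu$ is a bijective assignment of $1,\dots,n$ to the boxes directly to the right of the north-steps of $\mu$ such that the numbers increase from bottom to top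 in each column. A diagonal labeling of $\nu$ is a bijective assignment of $1,\dots,n$ to the boxes on the main diagonal such that for each pair of consecutive steps $EN$ of $\nu$ the number in the same column as the $E$-step is smaller than the number in the same row as the $N$-step. Zeta maps. The area vector of $\mu$ is $\mathbf{a}(\mu)=(a_1,\dots,a_n)$, where $a_i$ is the number of unit boxes in row $i$ (from the bottom) lying entirely below $\mu$ and above the main diagonal; area vectors are exactly the nonnegative integer sequences with $a_1=0$, $a_{i+1}\le a_i+1$, and $\mathbf{a}(\mu)$ determines $\mu$. The zeta map $\zeta$ is the bijection on Dyck paths with $2n$ steps whose inverse is: for $\nu$ with bounce parameters $b_0<\dots<b_r$ and $k\in\{1,\dots,r-1\}$, let $\mathbf{a}^{(k)}$ be obtained from the subpath of $\nu$ from $(b_{k-1},b_k)$ to $(b_k,b_{k+1})$ by replacing each $E$ by $k-1$ and each $N$ by $k$; then $\mathbf{a}(\zeta^{-1}(\nu))$ is the unique area vector of length $n$ with exactly $b_{k+1}-b_k$ entries equal to $k$ for $0\le k\le r-1$ whose subsequence of entries in $\{k-1,k\}$ is $\mathbf{a}^{(k)}$ for every $k\in\{1,\dots,r-1\}$. The Haglund--Loehr map is $\widetilde\zeta(\mu,P)=(\zeta(\mu),Q)$, where the labels of $Q$, read in the north-east direction along the main diagonal, are the labels of $P$ read along the diagonals $y=x+i$, in the north-east direction, for $i=0,1,\dots,n-1$ successively. Labeled horizontal LAC trees. In a plane rooted tree the children of each node are linearly ordered from left to right. For a plane rooted tree $T$ with $n$ non-root nodes, let $\alpha_T=(\alpha_1,\alpha_2,\dots)$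 with $\alpha_i$ the number of nodes at distance exactly $i$ from the root, and color each non-root node by its distance to the root. A right increasing labeling $R$ of $T$ is a bijective assignment of $1,\dots,n$ to the non-root nodes such that $R(v)>R(u)$ whenever $v$ is the rightmost child of a non-root node $u$. Let $\widetilde{LAC}_n$ be the set of triples $(T,\alpha_T,R)$. Map $\widetilde\Xi_{\mathrm{steep}}$. Given $(T,\alpha_T,R)$, traverse $T$ by depth-first search from the root visiting children from right to left; write $N$ when a new non-root node is visited and $E$ when returning to an already visited node (moving up to a parent). This gives a Dyck path $\mu$ whose north-steps correspond to the non-root nodes; $P$ assigns to each north-step the $R$-label of its node. Put $\widetilde\Xi_{\mathrm{steep}}(T,\alpha_T,R)=(\mu,\mu_{\mathrm{steep}},P)$. (Writing $N_\bullet$ when a node of a new color is met and $N_\circ$ otherwise, $\mu_{\mathrm{steep}}$ is obtained from this word by deleting all $E$, replacing $N_\bullet$ by $N$ and $N_\circ$ by $EN$, and appending east-steps up to $(n,n)$.) Map $\widetilde\Xi_{\mathrm{bounce}}$. Given $(T,\alpha_T,R)$ with $\alpha_T=(\alpha_1,\dots,\alpha_r)$, $s_k=\alpha_1+\dots+\alpha_k$, for each non-root non-leaf node $u$: if $u$ is the $i$-th node from the left at distance $k$ from the root and its rightmost child is the $j$-th node from the left at distance $k+1$, mark the point $(s_k-i+1,\ s_k+\alpha_{k+1}-j)$. Let $\nu$ be the unique Dyck path with $2n$ steps whose valleys are exactly the marked points; its bounce path is $\nu_{\mathrm{bounce}}=N^{\alpha_1}E^{\alpha_1}\cdots N^{\alpha_r}E^{\alpha_r}$.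 The labels of $Q$, from bottom to top on the main diagonal, are the $R$-labels of the nodes of color $1$ read from right to left, then those of color $2$ read from right to left, and so on. Put $\widetilde\Xi_{\mathrm{bounce}}(T,\alpha_T,R)=(\nu_{\mathrm{bounce}},\nu,Q)$. Both maps are bijections from $\widetilde{LAC}_n$ onto the sets in (a) and (b) respectively, and $\widetilde\Gamma=\widetilde\Xi_{\mathrm{bounce}}\circ\widetilde\Xi_{\mathrm{steep}}^{-1}$. *)

theory Defs
  imports Main "HOL-Library.FuncSet"
begin

section \<open>Dyck paths\<close>

datatype step = N | E

definition pt :: "step list \<Rightarrow> nat \<Rightarrow> nat \<times> nat" where
  "pt w k = (count_list (take k w) E, count_list (take k w) N)"

definition points :: "step list \<Rightarrow> (nat \<times> nat) set" where
  "points w = {pt w k | k. k \<le> length w}"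

definition dyck_paths :: "nat \<Rightarrow> step list set" where
  "dyck_paths n = {w. pt w (length w) = (n, n) \<and> (\<forall>(x, y) \<in> points w. x \<le> y)}"

definition valleys :: "step list \<Rightarrow> (nat \<times> nat) set" where
  "valleys w = {pt w (Suc k) | k. Suc k < length w \<and> w ! k = E \<and> w ! Suc k = N}"

definition weakly_above :: "step list \<Rightarrow> nat \<times> nat \<Rightarrow> bool" where
  "weakly_above w p \<longleftrightarrow> (\<exists>y \<le> snd p. (fst p, y) \<in> points w)"

definition weakly_below :: "step list \<Rightarrow> nat \<times> nat \<Rightarrow> bool" where
  "weakly_below w p \<longleftrightarrow> (\<exists>y \<ge> snd p. (fst p, y) \<in> points w)"


section \<open>Steep and bounce path\<close>

text \<open>
  An east-step stays weakly above a lattice path as soon as its right end point does.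
  Each recursive call takes a north-step first, followed by an east-step if possible.
\<close>

function steep_from :: "step list \<Rightarrow> nat \<Rightarrow> nat \<Rightarrow> nat \<Rightarrow> step list" where
  "steep_from w n x y =
     (if n \<le> y then replicate (n - x) E
      else if weakly_above w (Suc x, Suc y) then N # E # steep_from w n (Suc x) (Suc y)
      else N # steep_from w n x (Suc y))"
  by pat_completeness auto
termination by (relation "measure (\<lambda>(w, n, x, y). n - y)") auto

declare steep_from.simps [simp del]

definition steep_path :: "step list \<Rightarrow> step list" where
  "steep_path w = steep_from w (count_list w N) 0 0"

text \<open>
  The guard \<open>b < h\<close> only serves termination: it holds on every Dyck path as long as \<open>b < n\<close>.
\<close>

function bounce_from :: "step list \<Rightarrow> nat \<Rightarrow> nat \<Rightarrow> step list" where
  "bounce_from w n b =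
     (let h = Max {y. weakly_below w (b, y)} in
      if b < n \<and> b < h
      then replicate (h - b) N @ replicate (h - b) E @ bounce_from w n h
      else [])"
  by pat_completeness auto
termination by (relation "measure (\<lambda>(w, n, b). n - b)") auto

declare bounce_from.simps [simp del]

definition bounce_path :: "step list \<Rightarrow> step list" where
  "bounce_path w = bounce_from w (count_list w N) 0"

definition bounce_params :: "step list \<Rightarrow> nat list" where
  "bounce_params w = sorted_list_of_set {x. (x, x) \<in> points (bounce_path w)}"


section \<open>Labelings\<close>

text \<open>
  Rows and columns are counted from 0, so that row \<open>i\<close> lies between \<open>y = i\<close> and \<open>y = i + 1\<close>.
  A vertical labeling is the list of its labels by row, a diagonal labeling the list of its
  labels from bottom to top. \<open>north_xs w ! i\<close> is the \<open>x\<close>-coordinate of the north-step in row \<open>i\<close>.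
\<close>

definition north_xs :: "step list \<Rightarrow> nat list" where
  "north_xs w = map (\<lambda>k. fst (pt w k)) (filter (\<lambda>k. w ! k = N) [0..<length w])"

definition label_list :: "nat \<Rightarrow> nat list \<Rightarrow> bool" where
  "label_list n L \<longleftrightarrow> length L = n \<and> bij_betw (\<lambda>i. L ! i) {..<n} {1..n}"

definition vertical_labeling :: "nat \<Rightarrow> step list \<Rightarrow> nat list \<Rightarrow> bool" where
  "vertical_labeling n w P \<longleftrightarrow> label_list n P \<and>
     (\<forall>i j. i < j \<and> j < n \<and> north_xs w ! i = north_xs w ! j \<longrightarrow> P ! i < P ! j)"

definition diagonal_labeling :: "nat \<Rightarrow> step list \<Rightarrow> nat list \<Rightarrow> bool" where
  "diagonal_labeling n w Q \<longleftrightarrow> label_list n Q \<and>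
     (\<forall>k. Suc k < length w \<and> w ! k = E \<and> w ! Suc k = N \<longrightarrow>
        Q ! fst (pt w k) < Q ! snd (pt w (Suc k)))"


section \<open>Zeta maps\<close>

text \<open>
  The box in column \<open>j\<close> and row \<open>i\<close> is below the path iff its upper left corner is, and above
  the main diagonal iff its lower right corner is.
\<close>

definition area_vec :: "step list \<Rightarrow> nat list" where
  "area_vec w =
     map (\<lambda>i. card {j. weakly_below w (j, Suc i) \<and> Suc j \<le> i}) [0..<count_list w N]"

text \<open>A lattice path visits the point \<open>(x, y)\<close> after \<open>x + y\<close> steps, if at all.\<close>

definition subpath :: "step list \<Rightarrow> nat \<times> nat \<Rightarrow> nat \<times> nat \<Rightarrow> step list" where
  "subpath w p q = take ((fst q + snd q) - (fst p + snd p)) (drop (fst p + snd p) w)"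

definition zeta_seq :: "step list \<Rightarrow> nat \<Rightarrow> nat list" where
  "zeta_seq w k =
     (let b = bounce_params w in
      map (\<lambda>s. case s of E \<Rightarrow> k - 1 | N \<Rightarrow> k)
        (subpath w (b ! (k - 1), b ! k) (b ! k, b ! Suc k)))"

definition zeta_area :: "step list \<Rightarrow> nat list \<Rightarrow> bool" where
  "zeta_area w a \<longleftrightarrow>
     (let b = bounce_params w; r = length b - 1 in
      (\<forall>k < r. count_list a k = b ! Suc k - b ! k) \<and>
      (\<forall>k \<in> {1..<r}. filter (\<lambda>c. c \<in> {k - 1, k}) a = zeta_seq w k))"

definition zeta_inv :: "nat \<Rightarrow> step list \<Rightarrow> step list" where
  "zeta_inv n \<nu> = (THE \<mu>. \<mu> \<in> dyck_paths n \<and> zeta_area \<nu> (area_vec \<mu>))"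

definition zeta :: "nat \<Rightarrow> step list \<Rightarrow> step list" where
  "zeta n = inv_into (dyck_paths n) (zeta_inv n)"

definition haglund_loehr :: "nat \<Rightarrow> step list \<times> nat list \<Rightarrow> step list \<times> nat list" where
  "haglund_loehr n = (\<lambda>(\<mu>, P).
     (zeta n \<mu>,
      concat (map (\<lambda>i. map (\<lambda>j. P ! j) (filter (\<lambda>j. j = north_xs \<mu> ! j + i) [0..<n])) [0..<n])))"


section \<open>Labeled horizontal LAC trees\<close>

text \<open>
  A node of a plane rooted tree is given by the path leading to it from the root: \<open>[]\<close> is the
  root, and \<open>u @ [i]\<close> is the \<open>i\<close>-th child of \<open>u\<close> from the left, counted from 0.
\<close>

datatype ptree = Node (children: "ptree list")

primrec is_node :: "nat list \<Rightarrow> ptree \<Rightarrow> bool" where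
  "is_node [] t \<longleftrightarrow> True"
| "is_node (i # u) t \<longleftrightarrow> i < length (children t) \<and> is_node u (children t ! i)"

primrec subtree :: "nat list \<Rightarrow> ptree \<Rightarrow> ptree" where
  "subtree [] t = t"
| "subtree (i # u) t = subtree u (children t ! i)"

definition nodes :: "ptree \<Rightarrow> nat list set" where
  "nodes t = {u. is_node u t}"

definition nonroot :: "ptree \<Rightarrow> nat list set" where
  "nonroot t = nodes t - {[]}"

definition leaf :: "ptree \<Rightarrow> nat list \<Rightarrow> bool" where
  "leaf t u \<longleftrightarrow> children (subtree u t) = []"

definition rightmost_child :: "ptree \<Rightarrow> nat list \<Rightarrow> nat list" where
  "rightmost_child t u = u @ [length (children (subtree u t)) - 1]"

text \<open>The nodes at distance \<open>k\<close> from the root, from left to right.\<close>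

primrec level :: "nat \<Rightarrow> ptree \<Rightarrow> nat list list" where
  "level 0 t = [[]]"
| "level (Suc k) t =
     concat (map (\<lambda>i. map (Cons i) (level k (children t ! i))) [0..<length (children t)])"

text \<open>
  \<open>alpha t\<close> lists \<open>\<alpha>\<^sub>1, \<dots>, \<alpha>\<^sub>r\<close> up to the height \<open>r\<close> of the tree, so \<open>\<alpha>\<^sub>i\<close> is \<open>alpha t ! (i - 1)\<close>.
\<close>

definition alpha :: "ptree \<Rightarrow> nat list" where
  "alpha t = map (\<lambda>i. card {u \<in> nodes t. length u = i}) [1..<Suc (Max (length ` nodes t))]"

definition right_increasing :: "nat \<Rightarrow> ptree \<Rightarrow> (nat list \<Rightarrow> nat) \<Rightarrow> bool" where
  "right_increasing n t R \<longleftrightarrow>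
     R \<in> extensional (nonroot t) \<and> bij_betw R (nonroot t) {1..n} \<and>
     (\<forall>u \<in> nonroot t. \<not> leaf t u \<longrightarrow> R u < R (rightmost_child t u))"

definition LAC :: "nat \<Rightarrow> (ptree \<times> nat list \<times> (nat list \<Rightarrow> nat)) set" where
  "LAC n = {(t, alpha t, R) | t R. card (nonroot t) = n \<and> right_increasing n t R}"


section \<open>The maps between trees and pairs of paths\<close>

text \<open>
  Depth-first search from right to left in the subtree \<open>t\<close> at node \<open>u\<close>: each step is recorded
  together with the node it leads to.
\<close>

function dfs :: "nat list \<Rightarrow> ptree \<Rightarrow> (step \<times> nat list) list" where
  "dfs u (Node ts) =
     concat (map (\<lambda>i. (N, u @ [i]) # dfs (u @ [i]) (ts ! i) @ [(E, u)]) (rev [0..<length ts]))"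
  by pat_completeness auto
termination
  by (relation "measure (\<lambda>(u, t). size t)")
     (auto simp: less_Suc_eq_le intro!: size_list_estimation')

definition Xi_steep ::
  "ptree \<times> nat list \<times> (nat list \<Rightarrow> nat) \<Rightarrow> step list \<times> step list \<times> nat list" where
  "Xi_steep = (\<lambda>(t, \<alpha>, R).
     let d = dfs [] t; \<mu> = map fst d; P = map (\<lambda>(s, u). R u) (filter (\<lambda>(s, u). s = N) d)
     in (\<mu>, steep_path \<mu>, P))"

definition nth_from_left :: "ptree \<Rightarrow> nat \<Rightarrow> nat \<Rightarrow> nat list \<Rightarrow> bool" where
  "nth_from_left t k i u \<longleftrightarrow> 1 \<le> i \<and> i \<le> length (level k t) \<and> level k t ! (i - 1) = u"

definition marked_points :: "ptree \<Rightarrow> nat list \<Rightarrow> (nat \<times> nat) set" where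
  "marked_points t \<alpha> =
     {(s - i + 1, s + \<alpha> ! k - j) | s k i j u.
        u \<in> nonroot t \<and> \<not> leaf t u \<and> s = sum_list (take k \<alpha>) \<and>
        nth_from_left t k i u \<and> nth_from_left t (Suc k) j (rightmost_child t u)}"

definition Xi_bounce ::
  "nat \<Rightarrow> ptree \<times> nat list \<times> (nat list \<Rightarrow> nat) \<Rightarrow> step list \<times> step list \<times> nat list" where
  "Xi_bounce n = (\<lambda>(t, \<alpha>, R).
     let \<nu> = (THE \<nu>. \<nu> \<in> dyck_paths n \<and> valleys \<nu> = marked_points t \<alpha>);
         Q = concat (map (\<lambda>k. map R (rev (level k t))) [1..<Suc (length \<alpha>)])
     in (bounce_path \<nu>, \<nu>, Q))"

definition Gamma ::
  "nat \<Rightarrow> step list \<times> step list \<times> nat list \<Rightarrow> step list \<times> step list \<times> nat list" where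
  "Gamma n = Xi_bounce n \<circ> inv_into (LAC n) Xi_steep"

end

theory Submission
  imports Defs
begin

text \<open>
  Both tree maps factor through the area vector \<open>a\<close> of \<open>\<mu>\<close>. If \<open>\<mu>\<close> is the word of a tree, the
  entries of \<open>a\<close> are the depths (minus one) of the nodes in right-to-left preorder, and a node has
  its rightmost child as successor exactly at the ascents \<open>a\<^sub>i\<^sub>+\<^sub>1 = a\<^sub>i + 1\<close>. Let \<open>\<nu>\<close> be the
  concatenation over \<open>k\<close> of the words obtained from the entries \<open>k - 1, k\<close> of \<open>a\<close> by
  \<open>k - 1 \<mapsto> E\<close>, \<open>k \<mapsto> N\<close>. The valleys of \<open>\<nu>\<close> are the points \<open>(rank i + 1, rank (i + 1))\<close> for the
  ascents \<open>i\<close>, where \<open>rank\<close> is the stable ranking of rows by \<open>a\<close>; these are the marked points of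
  the tree, so \<open>\<nu>\<close> is the path of the bounce map, and the labeling conditions at ascents of \<open>\<mu>\<close> and
  at valleys of \<open>\<nu>\<close> coincide. The bounce path of \<open>\<nu>\<close> cuts it into the words above, hence
  \<open>\<nu> = \<zeta>(\<mu>)\<close>. An area vector is determined by these words, so \<open>\<mu> \<mapsto> \<nu>\<close> is injective, and
  bijective by finiteness.
\<close>

section \<open>Dyck words and their valleys\<close>

lemma pt_Cons:
  "pt (N # w) (Suc k) = (fst (pt w k), Suc (snd (pt w k)))"
  "pt (E # w) (Suc k) = (Suc (fst (pt w k)), snd (pt w k))"
  by (simp_all add: pt_def)

lemma pt_0 [simp]: "pt w 0 = (0, 0)"
  by (simp add: pt_def)

lemma points_conv: "points w = pt w ` {..length w}"
  by (auto simp: points_def)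

lemma points_Nil: "points [] = {(0, 0)}"
  by (simp add: points_conv)

lemma points_Cons:
  "points (N # w) = insert (0, 0) ((\<lambda>(x, y). (x, Suc y)) ` points w)"
  "points (E # w) = insert (0, 0) ((\<lambda>(x, y). (Suc x, y)) ` points w)"
  unfolding points_conv by (simp_all add: atMost_Suc_eq_insert_0 image_image pt_Cons split_def)

lemma origin_in_points: "(0, 0) \<in> points w"
  unfolding points_conv by (rule image_eqI[of _ _ 0]) simp_all

lemma points_append:
  "points (u @ v) = points u \<union> (\<lambda>(x, y). (count_list u E + x, count_list u N + y)) ` points v"
proof (induction u)
  case Nil
  show ?case using origin_in_points[of v] by (auto simp: points_Nil)
next
  case (Cons s u)
  then show ?case
    by (cases s) (simp_all add: points_Cons image_Un image_image split_def)
qed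

lemma points_bounds: "(x, y) \<in> points w \<Longrightarrow> x \<le> count_list w E \<and> y \<le> count_list w N"
proof -
  assume "(x, y) \<in> points w"
  then obtain k where "x = count_list (take k w) E" "y = count_list (take k w) N"
    by (auto simp: points_def pt_def)
  then show ?thesis
    using count_list_append[of "take k w" "drop k w"] by simp
qed

lemma ex_point_in_column: "(\<exists>y. (x, y) \<in> points w) \<longleftrightarrow> x \<le> count_list w E"
proof (induction w arbitrary: x)
  case Nil
  then show ?case by (simp add: points_Nil)
next
  case (Cons s w)
  show ?case
  proof (cases s)
    case N
    then have "(\<exists>y. (x, y) \<in> points (s # w)) \<longleftrightarrow> x = 0 \<or> (\<exists>y. (x, y) \<in> points w)"
      by (force simp: points_Cons)
    then show ?thesis using Cons N by auto
  next
    case E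
    then have "(\<exists>y. (x, y) \<in> points (s # w)) \<longleftrightarrow>
        x = 0 \<or> (\<exists>x'. x = Suc x' \<and> (\<exists>y. (x', y) \<in> points w))"
      by (force simp: points_Cons)
    then show ?thesis using Cons E by (cases x) auto
  qed
qed

section \<open>Dyck words as a recursive predicate, and their heights\<close>

lemma count_list_steps: "length w = count_list w E + count_list w N"
proof (induction w)
  case (Cons s w)
  then show ?case by (cases s) auto
qed simp

text \<open>The Dyck condition for a suffix that starts at distance \<open>h\<close> above the
  diagonal. Unlike \<open>dyck_paths\<close>, it consumes the word from the front, which suits
  induction.\<close>

fun closes :: "nat \<Rightarrow> step list \<Rightarrow> bool" where
  "closes h [] \<longleftrightarrow> h = 0"
| "closes h (N # w) \<longleftrightarrow> closes (Suc h) w"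
| "closes h (E # w) \<longleftrightarrow> h > 0 \<and> closes (h - 1) w"

lemma closes_iff:
  "closes h w \<longleftrightarrow> count_list w E = h + count_list w N \<and> (\<forall>(x, y) \<in> points w. x \<le> h + y)"
proof (induction h w rule: closes.induct)
  case (3 h w)
  show ?case
  proof (cases h)
    case 0
    \<comment> \<open>At \<open>h = 0\<close> the leading east-step itself ends below the diagonal,
      which is why \<open>closes\<close> demands \<open>h > 0\<close>.\<close>
    have "(1, 0) \<in> points (E # w)" using origin_in_points[of w] by (force simp: points_Cons)
    then have "\<not> (\<forall>(x, y) \<in> points (E # w). x \<le> 0 + y)" by (metis (mono_tags) add_0 case_prod_conv not_one_le_zero)
    then show ?thesis using 0 by simp
  next
    case (Suc h')
    then show ?thesis using 3 by (auto simp: points_Cons)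
  qed
qed (auto simp: points_Nil points_Cons)

lemma dyck_paths_iff: "w \<in> dyck_paths n \<longleftrightarrow> closes 0 w \<and> count_list w N = n"
  by (auto simp: dyck_paths_def closes_iff pt_def)

lemma finite_dyck_paths: "finite (dyck_paths n)"
proof (rule finite_subset)
  have U: "(UNIV :: step set) = {N, E}" using step.exhaust by auto
  show "dyck_paths n \<subseteq> {w. set w \<subseteq> UNIV \<and> length w = 2 * n}"
    by (auto simp: dyck_paths_def pt_def count_list_steps)
  show "finite {w :: step list. set w \<subseteq> UNIV \<and> length w = 2 * n}"
    by (rule finite_lists_length_eq) (simp add: U)
qed

text \<open>\<open>heights 0 w\<close> lists the distances to the main diagonal of the starting points of the
  north-steps, which for a Dyck path is its area vector.\<close>

fun heights :: "nat \<Rightarrow> step list \<Rightarrow> nat list" where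
  "heights h [] = []"
| "heights h (N # w) = h # heights (Suc h) w"
| "heights h (E # w) = heights (h - 1) w"

lemma length_heights [simp]: "length (heights h w) = count_list w N"
  by (induction h w rule: heights.induct) auto

lemma hd_heights_le: "heights h w \<noteq> [] \<Longrightarrow> hd (heights h w) \<le> h"
  by (induction h w rule: heights.induct) auto

lemma successively_heights: "successively (\<lambda>x y. y \<le> Suc x) (heights h w)"
  by (induction h w rule: heights.induct) (auto simp: successively_Cons dest: hd_heights_le)

text \<open>The first letter can be recovered: after \<open>N\<close> the list starts with
  \<open>h\<close>, whereas after \<open>E\<close> its head, if any, is at most
  \<open>h - 1\<close>, which is less than \<open>h\<close> because \<open>closes\<close> gives
  \<open>h > 0\<close>.\<close>

lemma heights_inj:
  "closes h w \<Longrightarrow> closes h w' \<Longrightarrow> heights h w = heights h w' \<Longrightarrow> w = w'"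
proof (induction h w arbitrary: w' rule: heights.induct)
  case (1 h)
  then show ?case by (cases "(h, w')" rule: closes.cases) auto
next
  case (2 h w)
  show ?case
  proof (cases w')
    case Nil
    then show ?thesis using 2 by simp
  next
    case (Cons s v)
    then show ?thesis using 2 hd_heights_le[of "h - 1" v] by (cases s) (auto dest: sym)
  qed
next
  case (3 h w)
  show ?case
  proof (cases w')
    case Nil
    then show ?thesis using 3 by simp
  next
    case (Cons s v)
    show ?thesis
    proof (cases s)
      case N
      then have "heights (h - 1) w = h # heights (Suc h) v" "h > 0" using 3 Cons by simp_all
      then show ?thesis using hd_heights_le[of "h - 1" w] by simp
    next
      case E
      then show ?thesis using 3 Cons by simp
    qed
  qed
qed

section \<open>Columns of the north-steps, and the area vector\<close>

lemma north_xs_Cons: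
  "north_xs (N # w) = 0 # north_xs w"
  "north_xs (E # w) = map Suc (north_xs w)"
proof -
  have "[0..<length (s # w)] = 0 # map Suc [0..<length w]" for s
    by (simp add: upt_conv_Cons map_Suc_upt del: upt_Suc)
  then show "north_xs (N # w) = 0 # north_xs w" "north_xs (E # w) = map Suc (north_xs w)"
    unfolding north_xs_def by (simp_all add: pt_Cons filter_map o_def)
qed

lemma north_xs_Nil: "north_xs [] = []"
  by (simp add: north_xs_def)

lemma length_north_xs [simp]: "length (north_xs w) = count_list w N"
proof (induction w)
  case (Cons s w)
  then show ?case by (cases s) (auto simp: north_xs_Cons)
qed (simp add: north_xs_Nil)

lemma sorted_north_xs: "sorted (north_xs w)"
proof (induction w)
  case (Cons s w)
  then show ?case by (cases s) (auto simp: north_xs_Cons sorted_map)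
qed (simp add: north_xs_Nil)

text \<open>The north-step of row \<open>i\<close> is preceded by \<open>i\<close> north-steps and
  \<open>north_xs w ! i\<close> east-steps. The equation is additive, and \<open>closes\<close>
  ensures that the subtraction \<open>h - 1\<close> in \<open>heights\<close> never
  truncates.\<close>

lemma heights_nth:
  "closes h w \<Longrightarrow> i < count_list w N \<Longrightarrow> h + i = heights h w ! i + north_xs w ! i"
proof (induction h w arbitrary: i rule: closes.induct)
  case (2 h w)
  then show ?case by (cases i) (fastforce simp: north_xs_Cons)+
next
  case (3 h w)
  then have "h - 1 + i = heights (h - 1) w ! i + north_xs w ! i" "h > 0" by simp_all
  then show ?case using 3(3) by (simp add: north_xs_Cons)
qed simp

text \<open>Column \<open>j\<close> reaches the top of row \<open>i\<close> exactly when the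
  north-step of that row has been taken by then. Columns beyond the last east-step contain no
  points, hence the second bound.\<close>

lemma weakly_below_iff:
  "i < count_list w N \<Longrightarrow>
    weakly_below w (j, Suc i) \<longleftrightarrow> north_xs w ! i \<le> j \<and> j \<le> count_list w E"
proof (induction w arbitrary: i j)
  case (Cons s w)
  show ?case
  proof (cases s)
    case N
    have "weakly_below (s # w) (j, Suc i) \<longleftrightarrow> (\<exists>y \<ge> i. (j, y) \<in> points w)"
      unfolding weakly_below_def N by (force simp: points_Cons)
    also have "\<dots> \<longleftrightarrow> north_xs (s # w) ! i \<le> j \<and> j \<le> count_list w E"
    proof (cases i)
      case 0
      then show ?thesis using N by (simp add: ex_point_in_column north_xs_Cons)
    next
      case (Suc i')
      then show ?thesis using Cons N by (simp add: weakly_below_def north_xs_Cons)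
    qed
    finally show ?thesis using N by simp
  next
    case E
    have "weakly_below (s # w) (j, Suc i) \<longleftrightarrow> (\<exists>j'. j = Suc j' \<and> weakly_below w (j', Suc i))"
      unfolding weakly_below_def E by (force simp: points_Cons)
    then show ?thesis using Cons E by (cases j) (auto simp: north_xs_Cons)
  qed
qed simp

lemma area_vec_eq_heights:
  assumes "w \<in> dyck_paths n"
  shows "area_vec w = heights 0 w"
proof (rule nth_equalityI)
  fix i assume "i < length (area_vec w)"
  then have i: "i < count_list w N" by (simp add: area_vec_def)
  have c: "closes 0 w" "count_list w E = count_list w N"
    using assms by (auto simp: dyck_paths_iff closes_iff)
  have "{j. weakly_below w (j, Suc i) \<and> Suc j \<le> i} = {north_xs w ! i..<i}"
    using i c(2) by (auto simp: weakly_below_iff)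
  then show "area_vec w ! i = heights 0 w ! i"
    using i heights_nth[OF c(1) i] by (simp add: area_vec_def)
qed (simp add: area_vec_def)

section \<open>Valleys of a word, and reconstruction of the word from them\<close>

lemma Collect_consecutive_Cons:
  "{f i | i. Suc i < length (x # a) \<and> P ((x # a) ! i) ((x # a) ! Suc i)} =
   {f (Suc i) | i. Suc i < length a \<and> P (a ! i) (a ! Suc i)} \<union>
   (if a \<noteq> [] \<and> P x (hd a) then {f 0} else {})" (is "?L = ?A \<union> ?B")
proof (intro equalityI subsetI)
  fix p assume "p \<in> ?L"
  then obtain i where "p = f i" "i < length a" "P ((x # a) ! i) (a ! i)" by auto
  then show "p \<in> ?A \<union> ?B" by (cases i) (auto simp: hd_conv_nth)
next
  fix p assume "p \<in> ?A \<union> ?B"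
  then show "p \<in> ?L"
  proof
    assume "p \<in> ?A"
    then obtain i where "p = f (Suc i)" "Suc i < length a" "P (a ! i) (a ! Suc i)" by auto
    then show ?thesis by (intro CollectI exI[of _ "Suc i"]) simp
  next
    assume "p \<in> ?B"
    then have "p = f 0" "a \<noteq> []" "P x (a ! 0)" by (auto simp: hd_conv_nth split: if_splits)
    then show ?thesis by (intro CollectI exI[of _ 0]) simp
  qed
qed

lemma valleys_Nil: "valleys [] = {}"
  by (simp add: valleys_def)

lemma valleys_Cons:
  "valleys (N # w) = (\<lambda>(x, y). (x, Suc y)) ` valleys w"
  "valleys (E # w) = (\<lambda>(x, y). (Suc x, y)) ` valleys w \<union>
     (if w \<noteq> [] \<and> hd w = N then {(1, 0)} else {})"
proof -
  have *: "valleys (s # w) =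
      {pt (s # w) (Suc (Suc k)) | k. Suc k < length w \<and> w ! k = E \<and> w ! Suc k = N} \<union>
      (if w \<noteq> [] \<and> s = E \<and> hd w = N then {pt (s # w) (Suc 0)} else {})" for s
    unfolding valleys_def
    by (rule Collect_consecutive_Cons[where P = "\<lambda>x y. x = E \<and> y = N" and f = "\<lambda>k. pt (s # w) (Suc k)"])
  show "valleys (N # w) = (\<lambda>(x, y). (x, Suc y)) ` valleys w"
    unfolding * unfolding valleys_def pt_Cons setcompr_eq_image image_image split_def by simp
  show "valleys (E # w) = (\<lambda>(x, y). (Suc x, y)) ` valleys w \<union>
     (if w \<noteq> [] \<and> hd w = N then {(1, 0)} else {})"
    unfolding * unfolding valleys_def pt_Cons setcompr_eq_image image_image split_def by simp
qed

lemma valleys_append: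
  "valleys (u @ v) = valleys u \<union> (\<lambda>(x, y). (count_list u E + x, count_list u N + y)) ` valleys v
     \<union> (if u \<noteq> [] \<and> last u = E \<and> v \<noteq> [] \<and> hd v = N
        then {(count_list u E, count_list u N)} else {})"
proof (induction u)
  case Nil
  then show ?case by (simp add: valleys_Nil)
next
  case (Cons s u)
  then show ?case
    by (cases s; cases "u = []")
      (auto simp: valleys_Cons valleys_Nil image_Un image_image split_def)
qed

text \<open>The last east-step before the first north-step ends at height 0 and is followed by
  \<open>N\<close>.\<close>

lemma ex_valley_at_0:
  "count_list w N > 0 \<Longrightarrow> \<exists>x. (x, 0) \<in> valleys (E # w)"
proof (induction w)
  case (Cons s w)
  show ?case
  proof (cases s)
    case N
    then show ?thesis by (auto simp: valleys_Cons)
  next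
    case E
    then have "\<exists>x. (x, 0) \<in> valleys (E # w)" using Cons by simp
    then show ?thesis unfolding E valleys_Cons(2)[of "E # w"] by force
  qed
qed simp

text \<open>The first letter can be read off: after a leading \<open>N\<close> every valley has
  positive height, while a leading \<open>E\<close> with an \<open>N\<close> somewhere behind it
  produces a valley at height 0. The equal counts guarantee such an \<open>N\<close> when the first
  letters differ.\<close>

lemma valleys_inj:
  "valleys w = valleys w' \<Longrightarrow> count_list w N = count_list w' N \<Longrightarrow>
    count_list w E = count_list w' E \<Longrightarrow> w = w'"
proof (induction w arbitrary: w')
  case Nil
  then show ?case using count_list_steps[of w'] by simp
next
  case (Cons s w)
  have "length w' = length (s # w)"
    unfolding count_list_steps using Cons.prems by simp
  then obtain s' v where w': "w' = s' # v" by (cases w') auto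
  have s: "s = s'"
  proof (rule ccontr)
    assume ne: "s \<noteq> s'"
    have no: "(x, 0) \<notin> valleys (N # u)" for x u by (auto simp: valleys_Cons)
    show False
      using ne Cons.prems no ex_valley_at_0[of w] ex_valley_at_0[of v] unfolding w'
      by (cases s; cases s') auto
  qed
  have inN: "inj (\<lambda>(x, y). (x, Suc y) :: nat \<times> nat)" by (auto intro: injI)
  have "valleys w = valleys v"
  proof (cases s)
    case N
    then show ?thesis using Cons.prems(1) inj_image_eq_iff[OF inN] unfolding w' s[symmetric]
      by (simp add: valleys_Cons)
  next
    case E
    \<comment> \<open>A valley is preceded by an east-step, so its first coordinate is positive. The
      condition \<open>x > 0\<close> below therefore discards only the valley \<open>(1, 0)\<close>
      that the leading \<open>E\<close> may create.\<close>
    have no: "(0, y) \<notin> valleys u" for y u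
    proof
      assume "(0, y) \<in> valleys u"
      then obtain k where "pt u (Suc k) = (0, y)" "Suc k < length u" "u ! k = E"
        unfolding valleys_def by auto
      then show False by (simp add: pt_def take_Suc_conv_app_nth)
    qed
    have shift: "valleys u = {(x, y). (Suc x, y) \<in> valleys (E # u) \<and> x > 0}" for u
    proof (intro equalityI subsetI)
      fix p assume "p \<in> valleys u"
      then show "p \<in> {(x, y). (Suc x, y) \<in> valleys (E # u) \<and> x > 0}"
        using no[of "snd p" u] by (cases p; cases "fst p") (force simp: valleys_Cons)+
    next
      fix p assume "p \<in> {(x, y). (Suc x, y) \<in> valleys (E # u) \<and> x > 0}"
      then show "p \<in> valleys u" by (auto simp: valleys_Cons split: if_splits)
    qed
    show ?thesis
      using Cons.prems(1) unfolding shift[of w] shift[of v] w' s[symmetric] E by (rule arg_cong)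
  qed
  then show ?case using Cons.IH[of v] Cons.prems unfolding w' s[symmetric] by (cases s) auto
qed

text \<open>At a valley \<open>(x, y)\<close> the east-step lies in column \<open>x - 1\<close> and
  the north-step in row \<open>y\<close>, so the labeling condition depends on the path only through
  its valleys.\<close>

lemma diagonal_labeling_iff:
  "diagonal_labeling n w Q \<longleftrightarrow> label_list n Q \<and> (\<forall>(x, y) \<in> valleys w. Q ! (x - 1) < Q ! y)"
proof -
  have "pt w (Suc k) = (Suc (fst (pt w k)), snd (pt w (Suc k)))"
    if "Suc k < length w" "w ! k = E" for k
    using that by (simp add: pt_def take_Suc_conv_app_nth)
  then have "fst (pt w k) = fst (pt w (Suc k)) - 1" if "Suc k < length w" "w ! k = E" for k
    using that by (metis diff_Suc_1 fst_conv)
  then have "(\<forall>k. Suc k < length w \<and> w ! k = E \<and> w ! Suc k = N \<longrightarrow>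
        Q ! fst (pt w k) < Q ! snd (pt w (Suc k))) \<longleftrightarrow>
      (\<forall>k. Suc k < length w \<and> w ! k = E \<and> w ! Suc k = N \<longrightarrow>
        Q ! (fst (pt w (Suc k)) - 1) < Q ! snd (pt w (Suc k)))"
    by auto
  then show ?thesis
    unfolding diagonal_labeling_def valleys_def split_def by blast
qed

section \<open>The zeta map through area vectors\<close>

definition is_area_vec :: "nat list \<Rightarrow> bool" where
  "is_area_vec a \<longleftrightarrow> successively (\<lambda>x y. y \<le> Suc x) a \<and> (a \<noteq> [] \<longrightarrow> hd a = 0)"

lemma is_area_vec_heights: "is_area_vec (heights 0 w)"
  using successively_heights hd_heights_le[of 0 w] by (auto simp: is_area_vec_def)

text \<open>Starting at 0 and rising by at most 1, the list skips no value up to its maximum. This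
  \<open>r\<close> will be the number of bounces of \<open>zpath a\<close>.\<close>

lemma is_area_vec_values:
  assumes "is_area_vec a"
  obtains r where "set a = {..<r}" "r \<le> length a"
proof -
  have "\<exists>r. set a = {..<r}"
    using assms
  proof (induction a rule: rev_induct)
    case (snoc x a)
    show ?case
    proof (cases "a = []")
      case True
      then have "set (a @ [x]) = {..<1}" using snoc.prems by (auto simp: is_area_vec_def)
      then show ?thesis ..
    next
      case False
      then have "is_area_vec a" "x \<le> Suc (last a)"
        using snoc.prems by (auto simp: is_area_vec_def successively_append_iff)
      then obtain r where r: "set a = {..<r}" using snoc.IH by blast
      then have "last a < r" using False last_in_set by auto
      then consider "x < r" | "x = r" using \<open>x \<le> Suc (last a)\<close> by linarith
      then show ?thesis
      proof cases
        case 1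
        then have "set (a @ [x]) = {..<r}" using r by auto
        then show ?thesis ..
      next
        case 2
        then have "set (a @ [x]) = {..<Suc r}" using r by (simp add: lessThan_Suc)
        then show ?thesis ..
      qed
    qed
  qed auto
  then obtain r where "set a = {..<r}" ..
  then show thesis using that card_length[of a] by auto
qed

text \<open>For \<open>set a = {..<r}\<close> and \<open>k \<le> r\<close> this will be the bounce
  parameter \<open>b_k\<close> of \<open>zpath a\<close>.\<close>

definition below :: "nat list \<Rightarrow> nat \<Rightarrow> nat" where
  "below a k = length (filter (\<lambda>c. c < k) a)"

lemma below_0 [simp]: "below a 0 = 0"
  by (simp add: below_def)

lemma below_Suc: "below a (Suc k) = below a k + count_list a k"
  unfolding below_def by (induction a) auto

lemma below_mono: "j \<le> k \<Longrightarrow> below a j \<le> below a k"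
  by (induction k rule: dec_induct) (auto simp: below_Suc)

lemma below_eq_length_iff: "below a k = length a \<longleftrightarrow> (\<forall>c \<in> set a. c < k)"
proof
  show "\<forall>c \<in> set a. c < k" if "below a k = length a"
    using that length_filter_less[of _ a "\<lambda>c. c < k"] by (force simp: below_def)
qed (simp add: below_def)

text \<open>Block \<open>k\<close> is the segment of \<open>\<zeta>(\<mu>)\<close> encoded by the entries \<open>k - 1\<close> and \<open>k\<close> of the area
  vector; block \<open>0\<close> is the initial run of north-steps.\<close>

definition block :: "nat list \<Rightarrow> nat \<Rightarrow> step list" where
  "block a k = map (\<lambda>c. if c = k then N else E) (filter (\<lambda>c. c = k \<or> Suc c = k) a)"

definition blocks :: "nat list \<Rightarrow> nat \<Rightarrow> step list" where
  "blocks a m = concat (map (block a) [0..<m])"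

text \<open>If \<open>set a = {..<r}\<close>, all blocks after block \<open>r\<close> are empty.
  Since \<open>r \<le> length a\<close>, the upper bound covers every nonempty block without
  mentioning \<open>r\<close>.\<close>

definition zpath :: "nat list \<Rightarrow> step list" where
  "zpath a = blocks a (Suc (length a))"

lemma block_Nil [simp]: "block [] k = []"
  by (simp add: block_def)

lemma block_Cons:
  "block (x # a) k = (if x = k then N # block a k else if Suc x = k then E # block a k else block a k)"
  by (simp add: block_def)

lemma count_block_N: "count_list (block a k) N = count_list a k"
  by (induction a) (auto simp: block_Cons)

lemma count_block_E: "count_list (block a k) E = (case k of 0 \<Rightarrow> 0 | Suc j \<Rightarrow> count_list a j)"
  by (induction a) (auto simp: block_Cons split: nat.split)

lemma blocks_0 [simp]: "blocks a 0 = []"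
  by (simp add: blocks_def)

lemma blocks_Suc: "blocks a (Suc m) = blocks a m @ block a m"
  by (simp add: blocks_def)

lemma count_blocks_N: "count_list (blocks a m) N = below a m"
  by (induction m) (auto simp: blocks_Suc count_block_N below_Suc)

text \<open>Block \<open>k\<close> takes its east-steps from the entries \<open>k - 1\<close>, so
  these lag one block behind the north-steps. Thus \<open>blocks a k\<close> ends at
  \<open>(b_(k-1), b_k)\<close> for \<open>k > 0\<close>.\<close>

lemma count_blocks_E: "count_list (blocks a m) E = below a (m - 1)"
proof (induction m)
  case (Suc m)
  then show ?case by (cases m) (auto simp: blocks_Suc count_block_E below_Suc)
qed simp

lemma zpath_split:
  assumes "k \<le> length a"
  obtains v where "zpath a = blocks a k @ block a k @ v"
proof -
  have "[0..<Suc (length a)] = [0..<k] @ k # [Suc k..<Suc (length a)]"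
    using assms upt_add_eq_append[of 0 k "Suc (length a) - k"] by (simp add: upt_conv_Cons del: upt_Suc)
  then show thesis using that by (simp add: zpath_def blocks_def)
qed

text \<open>To climb from below \<open>k\<close> in steps of at most 1, the list must meet
  \<open>k - 1\<close> before \<open>k\<close>.\<close>

lemma hd_block:
  "successively (\<lambda>x y. y \<le> Suc x) a \<Longrightarrow> hd a < k \<Longrightarrow> block a k \<noteq> [] \<Longrightarrow> hd (block a k) = E"
  by (induction a) (auto simp: block_Cons successively_Cons split: if_splits)

lemma hd_block_Suc: "is_area_vec a \<Longrightarrow> block a (Suc k) \<noteq> [] \<Longrightarrow> hd (block a (Suc k)) = E"
  by (rule hd_block) (auto simp: is_area_vec_def)

text \<open>Inside block \<open>m\<close> the first coordinate is at most \<open>below a m\<close>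
  and the second is at least \<open>below a m\<close>, so the path never crosses the
  diagonal.\<close>

lemma zpath_in_dyck_paths:
  assumes "is_area_vec a"
  shows "zpath a \<in> dyck_paths (length a)"
proof -
  obtain r where r: "set a = {..<r}" "r \<le> length a" using assms by (rule is_area_vec_values)
  then have "below a (length a) = length a" "below a (Suc (length a)) = length a"
    by (auto simp: below_eq_length_iff)
  moreover have "x \<le> y" if "(x, y) \<in> points (blocks a m)" for x y m
    using that
  proof (induction m arbitrary: x y)
    case 0
    then show ?case by (simp add: points_Nil)
  next
    case (Suc m)
    from Suc.prems consider "(x, y) \<in> points (blocks a m)" |
      x' y' where "(x', y') \<in> points (block a m)" "x = below a (m - 1) + x'" "y = below a m + y'"
      unfolding blocks_Suc points_append by (auto simp: count_blocks_N count_blocks_E)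
    then show ?case
    proof cases
      case 1
      then show ?thesis by (rule Suc.IH)
    next
      case 2
      then have "x' \<le> count_list (block a m) E" using points_bounds by blast
      then show ?thesis using 2 by (cases m) (auto simp: count_block_E below_Suc)
    qed
  qed
  ultimately show ?thesis
    by (auto simp: dyck_paths_def pt_def zpath_def count_blocks_N count_blocks_E)
qed

text \<open>The lists are rebuilt entry by entry. If the first entries were \<open>x < y\<close>,
  block \<open>y\<close> of the first list would not start with \<open>N\<close> by
  \<open>hd_block\<close>, while that of the second does. So the first entries agree and can be
  removed from all blocks.\<close>

lemma block_determines:
  assumes "successively (\<lambda>x y. y \<le> Suc x) a" "successively (\<lambda>x y. y \<le> Suc x) a'"
    and "\<And>k. block a k = block a' k"
  shows "a = a'"
  using assms
proof (induction a arbitrary: a')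
  case Nil
  then show ?case by (cases a') (metis block_Cons block_Nil list.distinct(1))+
next
  case (Cons x s)
  obtain y s' where a': "a' = y # s'"
    using Cons.prems(3)[of x] by (cases a') (auto simp: block_Cons)
  have "\<not> x < y"
    using hd_block[OF Cons.prems(1), of y] Cons.prems(3)[of y] unfolding a' by (auto simp: block_Cons[of y s'])
  moreover have "\<not> y < x"
    using hd_block[OF Cons.prems(2), of x] Cons.prems(3)[of x, symmetric] unfolding a'
    by (auto simp: block_Cons[of x s])
  ultimately have "x = y" by simp
  moreover have "block s k = block s' k" for k
    using Cons.prems(3)[of k] by (auto simp: a' \<open>x = y\<close> block_Cons split: if_splits)
  ultimately show ?case
    using Cons.IH[of s'] Cons.prems(1,2) by (auto simp: a' successively_Cons)
qed

section \<open>The bounce path of \<open>zpath a\<close>\<close>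

lemma Max_weakly_below:
  assumes "w = u @ E # v"
  shows "Max {y. weakly_below w (count_list u E, y)} = count_list u N"
proof -
  \<comment> \<open>After the cut the path leaves the column \<open>count_list u E\<close>, so the
    cut point is the highest one in it.\<close>
  have "(count_list u E, y) \<in> points w \<Longrightarrow> y \<le> count_list u N" for y
    unfolding assms points_append points_Cons using points_bounds[of _ y u] by auto
  moreover have "(count_list u E, count_list u N) \<in> points w"
    unfolding assms points_append points_Cons by auto
  ultimately have "{y. weakly_below w (count_list u E, y)} = {..count_list u N}"
    unfolding weakly_below_def by (auto intro: le_trans)
  then show ?thesis by (auto intro!: Max_eqI)
qed

lemma points_replicate:
  "points (replicate c N) = Pair 0 ` {..c}" "points (replicate c E) = (\<lambda>x. (x, 0)) ` {..c}"
  by (induction c)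
    (simp_all add: points_Nil points_Cons image_image atMost_Suc_eq_insert_0)

lemma count_list_replicate: "count_list (replicate c x) y = (if x = y then c else 0)"
  by (induction c) auto

text \<open>Each peak starts and ends on the diagonal and is strictly above it in between, so the
  contact points are the partial sums of the multiplicities.\<close>

lemma diagonal_points_bounce:
  "{x. (x, x) \<in> points (concat (map (\<lambda>j. replicate (count_list a j) N @ replicate (count_list a j) E) [0..<r]))}
     = below a ` {..r}"
proof (induction r)
  case 0
  then show ?case by (auto simp: points_Nil)
next
  case (Suc r)
  define w where "w = concat (map (\<lambda>j. replicate (count_list a j) N @ replicate (count_list a j) E) [0..<r])"
  have c: "count_list w s = below a r" for s
    unfolding w_def by (induction r; cases s) (auto simp: count_list_replicate below_Suc)
  have "{x. (x, x) \<in> points (w @ replicate (count_list a r) N @ replicate (count_list a r) E)} =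
      {x. (x, x) \<in> points w} \<union> {below a r, below a (Suc r)}"
    by (auto simp: c points_append points_replicate count_list_replicate below_Suc
        image_Un image_image image_iff Bex_def)
  then show ?case using Suc by (auto simp: w_def atMost_Suc)
qed

text \<open>A bounce from \<open>(b_k, b_k)\<close> climbs the column \<open>b_k\<close>. The word
  \<open>blocks a (Suc k)\<close> ends at \<open>(b_k, b_(k+1))\<close> and block
  \<open>Suc k\<close> begins with \<open>E\<close>, so the path leaves that column at height
  \<open>b_(k+1)\<close>.\<close>

lemma bounce_from_zpath:
  assumes "is_area_vec a" "set a = {..<r}" "k \<le> r"
  shows "bounce_from (zpath a) (length a) (below a k) =
    concat (map (\<lambda>j. replicate (count_list a j) N @ replicate (count_list a j) E) [k..<r])"
  using assms(3)
proof (induction rule: inc_induct)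
  case base
  have "below a r = length a" using assms(2) by (simp add: below_eq_length_iff)
  then show ?case by (simp add: bounce_from.simps[of _ _ "length a"] Let_def)
next
  case (step k)
  \<comment> \<open>Each value below \<open>r\<close> occurs, which makes block \<open>Suc k\<close>
    nonempty and satisfies the guard \<open>b < h\<close> of \<open>bounce_from\<close>.\<close>
  have "k \<in> set a" using step assms(2) by simp
  then have c: "count_list a k > 0" by (metis count_list_0_iff gr0I)
  have "r \<le> length a" using assms(2) card_length[of a] by simp
  then obtain v where v: "zpath a = blocks a (Suc k) @ block a (Suc k) @ v"
    using zpath_split[of "Suc k" a] step by auto
  have "count_list (block a (Suc k)) E > 0" using c by (simp add: count_block_E)
  then have "block a (Suc k) \<noteq> []" by auto
  with hd_block_Suc[OF assms(1)] obtain v' where "block a (Suc k) = E # v'"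
    by (metis list.collapse)
  with v have "zpath a = blocks a (Suc k) @ E # v' @ v" by simp
  from Max_weakly_below[OF this]
  have M: "Max {y. weakly_below (zpath a) (below a k, y)} = below a (Suc k)"
    by (simp add: count_blocks_E count_blocks_N)
  have "below a (Suc k) \<le> length a" by (simp add: below_def)
  then have "bounce_from (zpath a) (length a) (below a k) =
      replicate (count_list a k) N @ replicate (count_list a k) E @
      bounce_from (zpath a) (length a) (below a (Suc k))"
    unfolding bounce_from.simps[of _ _ "below a k"] M using c by (simp add: below_Suc)
  then show ?case using step by (simp add: upt_conv_Cons)
qed

lemma bounce_params_zpath:
  assumes "is_area_vec a" "set a = {..<r}"
  shows "bounce_params (zpath a) = map (below a) [0..<Suc r]"
proof -
  have "count_list (zpath a) N = length a"
    using zpath_in_dyck_paths[OF assms(1)] by (simp add: dyck_paths_def pt_def)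
  then have "bounce_params (zpath a) = sorted_list_of_set (below a ` {..r})"
    using bounce_from_zpath[OF assms, of 0] diagonal_points_bounce[of a r]
    by (simp add: bounce_params_def bounce_path_def)
  also have "below a ` {..r} = set (map (below a) [0..<Suc r])"
    by (simp add: atLeast0LessThan lessThan_Suc_atMost del: upt_Suc)
  also have "sorted_list_of_set \<dots> = map (below a) [0..<Suc r]"
  proof (rule sorted_list_of_set.idem_if_sorted_distinct)
    \<comment> \<open>Again because every value below \<open>r\<close> occurs, the parameters are
      strictly increasing, and sorting their set returns the list.\<close>
    have "below a i < below a j" if "i < j" "j < Suc r" for i j
    proof -
      have "i \<in> set a" using that assms(2) by simp
      then have "0 < count_list a i" by (metis count_list_0_iff gr0I)
      then have "below a i < below a (Suc i)" by (simp add: below_Suc)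
      also have "\<dots> \<le> below a j" using that by (intro below_mono) simp
      finally show ?thesis .
    qed
    then have "sorted_wrt (<) (map (below a) [0..<Suc r])"
      by (simp add: sorted_wrt_map sorted_wrt_iff_nth_less nth_append del: upt_Suc)
    then show "sorted (map (below a) [0..<Suc r])" "distinct (map (below a) [0..<Suc r])"
      by (simp_all only: strict_sorted_iff)
  qed
  finally show ?thesis .
qed

section \<open>Zeta sequences, and the identification of \<open>zmap\<close> with the zeta
  map\<close>

lemma zeta_seq_zpath:
  assumes "is_area_vec a" "set a = {..<r}" "0 < k" "k < r"
  shows "zeta_seq (zpath a) k = filter (\<lambda>c. c \<in> {k - 1, k}) a"
proof -
  have "r \<le> length a" using assms(2) card_length[of a] by simp
  then obtain v where v: "zpath a = blocks a k @ block a k @ v"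
    using zpath_split[of k a] assms by auto
  have b: "bounce_params (zpath a) ! j = below a j" if "j \<le> r" for j
    using that by (simp add: bounce_params_zpath[OF assms(1,2)] nth_append less_Suc_eq_le del: upt_Suc)
  \<comment> \<open>A path reaches \<open>(x, y)\<close> after \<open>x + y\<close> steps, so the
    lengths in \<open>l1\<close> and \<open>l2\<close> show that \<open>subpath\<close> cuts out
    exactly block \<open>k\<close>.\<close>
  have l1: "length (blocks a k) = below a (k - 1) + below a k"
    unfolding count_list_steps[of "blocks a k"] count_blocks_E count_blocks_N ..
  have "length (block a k) = count_list a (k - 1) + count_list a k"
    unfolding count_list_steps[of "block a k"] count_block_E count_block_N
    using assms(3) by (cases k) auto
  then have l2: "below a k + below a (Suc k) - (below a (k - 1) + below a k) = length (block a k)"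
    using below_Suc[of a "k - 1"] below_Suc[of a k] assms(3) by simp
  have "subpath (zpath a) (below a (k - 1), below a k) (below a k, below a (Suc k)) = block a k"
    unfolding subpath_def fst_conv snd_conv l2 by (simp add: v l1)
  moreover have "map (\<lambda>s. case s of E \<Rightarrow> k - 1 | N \<Rightarrow> k) (block a k) = filter (\<lambda>c. c \<in> {k - 1, k}) a"
  proof -
    obtain j where j: "k = Suc j" using assms(3) by (cases k) auto
    show ?thesis unfolding j diff_Suc_1 by (induction a) (simp_all add: block_Cons)
  qed
  ultimately show ?thesis
    unfolding zeta_seq_def Let_def using b[of "k - 1"] b[of k] b[of "Suc k"] assms(4)
    by (simp only: Suc_leI less_imp_le less_imp_diff_less)
qed

text \<open>This supplies the uniqueness behind \<open>zeta_inv\<close>. The conditions of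
  \<open>zeta_area\<close> give the blocks \<open>1, ..., r - 1\<close>; each remaining block
  contains at most one kind of step and follows from the multiplicities.\<close>

lemma zeta_area_zpath_iff:
  assumes "is_area_vec a" "is_area_vec a'" "length a' = length a"
  shows "zeta_area (zpath a) a' \<longleftrightarrow> a' = a"
proof -
  obtain r where r: "set a = {..<r}" using assms(1) by (rule is_area_vec_values)
  have b: "bounce_params (zpath a) ! j = below a j" if "j \<le> r" for j
    using that by (simp add: bounce_params_zpath[OF assms(1) r] nth_append less_Suc_eq_le del: upt_Suc)
  have l: "length (bounce_params (zpath a)) = Suc r" by (simp add: bounce_params_zpath[OF assms(1) r])
  have "zeta_area (zpath a) a' \<longleftrightarrow> (\<forall>k<r. count_list a' k = count_list a k) \<and>
      (\<forall>k \<in> {1..<r}. filter (\<lambda>c. c \<in> {k - 1, k}) a' = filter (\<lambda>c. c \<in> {k - 1, k}) a)"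
    unfolding zeta_area_def Let_def l
    by (auto simp: b below_Suc zeta_seq_zpath[OF assms(1) r])
  moreover have "a' = a"
    if c: "\<forall>k<r. count_list a' k = count_list a k"
      and f: "\<forall>k \<in> {1..<r}. filter (\<lambda>c. c \<in> {k - 1, k}) a' = filter (\<lambda>c. c \<in> {k - 1, k}) a"
  proof (rule block_determines)
    \<comment> \<open>Since \<open>a'\<close> has the length of \<open>a\<close>, matching
      multiplicities below \<open>r\<close> leave no room for entries from \<open>r\<close>
      on.\<close>
    have "below a' k = below a k" if "k \<le> r" for k
      using that c by (induction k) (auto simp: below_Suc)
    then have "below a' r = length a'"
      using r assms(3) by (metis below_eq_length_iff lessThan_iff order_refl)
    then have r': "\<forall>c \<in> set a'. c < r" by (simp add: below_eq_length_iff)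
    have const: "filter (\<lambda>c. c = x) d = replicate (count_list d x) x" for x :: nat and d
      by (induction d) auto
    have c': "count_list a' k = count_list a k" for k
    proof (cases "k < r")
      case False
      then have "k \<notin> set a" "k \<notin> set a'" using r r' by auto
      then show ?thesis by (simp add: count_list_0_iff)
    qed (use c in simp)
    fix k
    consider "k = 0" | "0 < k" "k < r" | "0 < k" "r \<le> k" by linarith
    then have "filter (\<lambda>c. c = k \<or> Suc c = k) a' = filter (\<lambda>c. c = k \<or> Suc c = k) a"
    proof cases
      case 1
      then show ?thesis by (simp add: const c')
    next
      case 2
      then have "(\<lambda>c. c = k \<or> Suc c = k) = (\<lambda>c. c \<in> {k - 1, k})" by auto
      then show ?thesis using f 2 by simp
    next
      case 3
      have "filter (\<lambda>c. c = k \<or> Suc c = k) d = filter (\<lambda>c. c = k - 1) d" if "\<forall>c \<in> set d. c < r" for d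
        using that 3 by (intro filter_cong) auto
      then show ?thesis using r r' by (simp add: const c')
    qed
    then show "block a' k = block a k" by (simp add: block_def)
  qed (use assms in \<open>auto simp: is_area_vec_def\<close>)
  ultimately show ?thesis by blast
qed

definition zmap :: "step list \<Rightarrow> step list" where
  "zmap \<mu> = zpath (heights 0 \<mu>)"

lemma inj_on_zmap: "inj_on zmap (dyck_paths n)"
proof (rule inj_onI)
  fix \<mu> \<mu>' assume m: "\<mu> \<in> dyck_paths n" "\<mu>' \<in> dyck_paths n" and "zmap \<mu> = zmap \<mu>'"
  let ?a = "heights 0 \<mu>" and ?a' = "heights 0 \<mu>'"
  have l: "length ?a' = length ?a" using m by (simp add: dyck_paths_iff)
  have "zeta_area (zpath ?a') ?a'" using zeta_area_zpath_iff is_area_vec_heights by blast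
  then have "zeta_area (zpath ?a) ?a'" using \<open>zmap \<mu> = zmap \<mu>'\<close> by (simp add: zmap_def)
  then have "?a' = ?a" using zeta_area_zpath_iff is_area_vec_heights l by blast
  then show "\<mu> = \<mu>'" using heights_inj[of 0 \<mu> \<mu>'] m by (simp add: dyck_paths_iff)
qed

lemma bij_betw_zmap: "bij_betw zmap (dyck_paths n) (dyck_paths n)"
proof -
  have "zmap ` dyck_paths n \<subseteq> dyck_paths n"
    using zpath_in_dyck_paths[OF is_area_vec_heights] by (auto simp: zmap_def dyck_paths_iff)
  then show ?thesis
    using endo_inj_surj[OF finite_dyck_paths _ inj_on_zmap] inj_on_zmap by (simp add: bij_betw_def)
qed

lemma zeta_inv_zmap:
  assumes "\<mu> \<in> dyck_paths n"
  shows "zeta_inv n (zmap \<mu>) = \<mu>"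
  unfolding zeta_inv_def
proof (rule the_equality)
  show "\<mu> \<in> dyck_paths n \<and> zeta_area (zmap \<mu>) (area_vec \<mu>)"
    using assms by (simp add: zmap_def area_vec_eq_heights zeta_area_zpath_iff is_area_vec_heights)
next
  fix \<mu>' assume "\<mu>' \<in> dyck_paths n \<and> zeta_area (zmap \<mu>) (area_vec \<mu>')"
  then have m: "\<mu>' \<in> dyck_paths n" and z: "zeta_area (zpath (heights 0 \<mu>)) (heights 0 \<mu>')"
    by (auto simp: zmap_def area_vec_eq_heights)
  have "length (heights 0 \<mu>') = length (heights 0 \<mu>)" using m assms by (simp add: dyck_paths_iff)
  then have "heights 0 \<mu>' = heights 0 \<mu>"
    using z zeta_area_zpath_iff is_area_vec_heights by blast
  then show "\<mu>' = \<mu>" using heights_inj m assms by (auto simp: dyck_paths_iff)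
qed

lemma zeta_eq_zmap:
  assumes "\<mu> \<in> dyck_paths n"
  shows "zeta n \<mu> = zmap \<mu>"
proof -
  \<comment> \<open>\<open>zeta\<close> is defined by \<open>inv_into\<close>, so
    \<open>zeta_inv\<close> must be injective. It is, because \<open>zmap\<close> maps onto
    \<open>dyck_paths n\<close> and \<open>zeta_inv\<close> undoes it.\<close>
  have "inj_on (zeta_inv n) (dyck_paths n)"
    using bij_betw_imp_surj_on[OF bij_betw_zmap, of n]
    by (metis (no_types, lifting) f_the_inv_into_f inj_on_inverseI inj_on_zmap the_inv_into_into
        order_refl zeta_inv_zmap)
  moreover have "zmap \<mu> \<in> dyck_paths n" using assms bij_betw_zmap by (auto simp: bij_betw_def)
  ultimately show ?thesis
    unfolding zeta_def using inv_into_f_f zeta_inv_zmap[OF assms] by metis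
qed

section \<open>Diagonal reading order\<close>

text \<open>\<open>rank a i\<close> is the position of row \<open>i\<close> in the reading order by diagonals.\<close>

definition rank :: "nat list \<Rightarrow> nat \<Rightarrow> nat" where
  "rank a i = below a (a ! i) + count_list (take i a) (a ! i)"

section \<open>Valleys of \<open>zpath a\<close> as ascents of \<open>a\<close>\<close>

lemma valleys_block_0: "valleys (block a 0) = {}"
  by (induction a) (auto simp: block_Cons valleys_Nil valleys_Cons)

text \<open>Entries \<open>j\<close> and \<open>Suc j\<close> that are neighbours after filtering
  are already neighbours in \<open>a\<close>: nothing above \<open>Suc j\<close> can directly follow
  \<open>j\<close>, and after a drop below \<open>j\<close> the list meets \<open>j\<close> again
  before \<open>Suc j\<close>.\<close>

lemma valleys_block_Suc:
  assumes "successively (\<lambda>x y. y \<le> Suc x) a"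
  shows "valleys (block a (Suc j)) =
    {(count_list (take (Suc i) a) j, count_list (take (Suc i) a) (Suc j)) | i.
       Suc i < length a \<and> a ! i = j \<and> a ! Suc i = Suc j}"
  using assms
proof (induction a)
  case (Cons x a)
  define f where "f b i = (count_list (take (Suc i) b) j, count_list (take (Suc i) b) (Suc j))" for b i
  define S where "S = {f a i | i. Suc i < length a \<and> a ! i = j \<and> a ! Suc i = Suc j}"
  have IH: "valleys (block a (Suc j)) = S"
    unfolding S_def f_def using Cons by (cases "a = []") (auto simp: successively_Cons valleys_Nil)
  have f: "f (x # a) (Suc i) =
      ((if x = j then 1 else 0) + fst (f a i), (if x = Suc j then 1 else 0) + snd (f a i))" for i
    by (auto simp: f_def)
  have R: "{f (x # a) i | i. Suc i < length (x # a) \<and> (x # a) ! i = j \<and> (x # a) ! Suc i = Suc j}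
      = (\<lambda>(u, v). ((if x = j then 1 else 0) + u, (if x = Suc j then 1 else 0) + v)) ` S
        \<union> (if a \<noteq> [] \<and> x = j \<and> hd a = Suc j then {(1, 0)} else {})"
    unfolding Collect_consecutive_Cons[where P = "\<lambda>x y. x = j \<and> y = Suc j" and f = "f (x # a)"]
    unfolding f S_def setcompr_eq_image image_image split_def by (simp add: f_def)
  have "a \<noteq> [] \<and> hd a = Suc j \<longleftrightarrow> block a (Suc j) \<noteq> [] \<and> hd (block a (Suc j)) = N" if "x = j"
  proof
    assume *: "block a (Suc j) \<noteq> [] \<and> hd (block a (Suc j)) = N"
    then have "a \<noteq> []" by auto
    then have "hd a \<le> Suc j" "successively (\<lambda>x y. y \<le> Suc x) a"
      using Cons.prems that by (simp_all add: successively_Cons)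
    moreover have "\<not> hd a < Suc j" using hd_block[of a "Suc j"] calculation(2) * by auto
    ultimately show "a \<noteq> [] \<and> hd a = Suc j" using \<open>a \<noteq> []\<close> by simp
  qed (cases a; simp add: block_Cons)
  then have "valleys (block (x # a) (Suc j)) =
      (\<lambda>(u, v). ((if x = j then 1 else 0) + u, (if x = Suc j then 1 else 0) + v)) ` S
        \<union> (if a \<noteq> [] \<and> x = j \<and> hd a = Suc j then {(1, 0)} else {})"
    by (auto simp: block_Cons valleys_Cons IH)
  then show ?case using R by (simp add: f_def)
qed (simp add: valleys_Nil)

text \<open>Counting the entry at \<open>i\<close> itself moves from the start to the end of its
  east-step, where the valley lies; hence \<open>Suc (rank a i)\<close>.\<close>

lemma rank_ascent:
  assumes "Suc i < length a" "a ! Suc i = Suc (a ! i)"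
  shows "Suc (rank a i) = below a (a ! i) + count_list (take (Suc i) a) (a ! i)"
    and "rank a (Suc i) = below a (Suc (a ! i)) + count_list (take (Suc i) a) (Suc (a ! i))"
  using assms by (simp_all add: rank_def take_Suc_conv_app_nth)

text \<open>No valley arises where two blocks meet, because every nonempty block after block 0
  begins with \<open>E\<close>.\<close>

lemma valleys_blocks:
  assumes "is_area_vec a"
  shows "valleys (blocks a m) = {(Suc (rank a i), rank a (Suc i)) | i.
    Suc i < length a \<and> a ! Suc i = Suc (a ! i) \<and> a ! Suc i < m}"
proof (induction m)
  case 0
  then show ?case by (simp add: valleys_Nil)
next
  case (Suc m)
  have s: "successively (\<lambda>x y. y \<le> Suc x) a" using assms by (simp add: is_area_vec_def)
  show ?case
  proof (cases m)
    case 0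
    then show ?thesis by (auto simp: blocks_Suc valleys_block_0)
  next
    case (Suc j)
    have "valleys (blocks a (Suc m)) = valleys (blocks a m) \<union>
        (\<lambda>(x, y). (below a j + x, below a m + y)) ` valleys (block a m)"
      unfolding blocks_Suc[of a m] valleys_append count_blocks_E count_blocks_N
      using hd_block_Suc[OF assms, of j] by (auto simp: Suc)
    also have "(\<lambda>(x, y). (below a j + x, below a m + y)) ` valleys (block a m) =
        {(Suc (rank a i), rank a (Suc i)) | i.
          Suc i < length a \<and> a ! Suc i = Suc (a ! i) \<and> a ! Suc i = m}"
      unfolding Suc valleys_block_Suc[OF s] setcompr_eq_image image_image split_def fst_conv snd_conv
      by (intro image_cong) (auto simp: rank_ascent)
    also have "valleys (blocks a m) \<union> \<dots> = {(Suc (rank a i), rank a (Suc i)) | i.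
        Suc i < length a \<and> a ! Suc i = Suc (a ! i) \<and> a ! Suc i < Suc m}"
      unfolding Suc.IH less_Suc_eq by blast
    finally show ?thesis .
  qed
qed

lemma area_vec_less:
  assumes "is_area_vec a" "c \<in> set a"
  shows "c < length a"
  using assms by (metis is_area_vec_values lessThan_iff less_le_trans)

lemma valleys_zpath:
  assumes "is_area_vec a"
  shows "valleys (zpath a) =
    {(Suc (rank a i), rank a (Suc i)) | i. Suc i < length a \<and> a ! Suc i = Suc (a ! i)}"
proof -
  have "a ! Suc i < Suc (length a)" if "Suc i < length a" for i
    using area_vec_less[OF assms nth_mem[OF that]] by simp
  then show ?thesis unfolding zpath_def valleys_blocks[OF assms] by blast
qed

section \<open>Reading the rows by diagonals: the inverse of \<open>rank\<close>\<close>

definition reading_order :: "nat list \<Rightarrow> nat list" where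
  "reading_order a = concat (map (\<lambda>i. filter (\<lambda>j. a ! j = i) [0..<length a]) [0..<length a])"

lemma map_nth_filter: "map ((!) a) (filter (\<lambda>j. P (a ! j)) [0..<length a]) = filter P a"
proof -
  have "filter P a = filter P (map ((!) a) [0..<length a])" by (simp only: map_nth)
  then show ?thesis by (simp add: filter_map o_def)
qed

lemma length_filter_nth_eq: "length (filter (\<lambda>j. a ! j = i) [0..<length a]) = count_list a i"
proof -
  have "length (filter (\<lambda>j. a ! j = i) [0..<length a]) = length (filter (\<lambda>c. c = i) a)"
    using arg_cong[OF map_nth_filter[of a "\<lambda>c. c = i"], of length] by simp
  also have "\<dots> = count_list a i" by (induction a) auto
  finally show ?thesis .
qed

lemma length_reading_prefix:
  "length (concat (map (\<lambda>i. filter (\<lambda>j. a ! j = i) [0..<length a]) [0..<m])) = below a m"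
  by (induction m) (simp_all add: length_filter_nth_eq below_Suc)

lemma length_reading_order:
  assumes "is_area_vec a"
  shows "length (reading_order a) = length a"
  unfolding reading_order_def length_reading_prefix below_eq_length_iff
  using area_vec_less[OF assms] by blast

lemma set_reading_order:
  assumes "is_area_vec a"
  shows "set (reading_order a) = {..<length a}"
  using area_vec_less[OF assms] by (auto simp: reading_order_def)

lemma distinct_reading_order:
  assumes "is_area_vec a"
  shows "distinct (reading_order a)"
  by (rule card_distinct) (simp add: set_reading_order length_reading_order assms)

text \<open>Before row \<open>i\<close> the list contains all rows on lower diagonals and then the
  earlier rows on the same diagonal; the two summands of \<open>rank\<close> count these.\<close>

lemma reading_order_rank:
  assumes "is_area_vec a" "i < length a"
  shows "rank a i < length a" "reading_order a ! rank a i = i"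
proof -
  let ?f = "\<lambda>c. filter (\<lambda>j. a ! j = c) [0..<length a]" and ?c = "a ! i"
  have "?c < length a" using area_vec_less assms by simp
  then have "[0..<length a] = [0..<?c] @ ?c # [Suc ?c..<length a]"
    using upt_add_eq_append[of 0 ?c "length a - ?c"] by (simp add: upt_conv_Cons)
  then have r: "reading_order a = concat (map ?f [0..<?c]) @ ?f ?c @ concat (map ?f [Suc ?c..<length a])"
    unfolding reading_order_def by simp
  have "[0..<length a] = [0..<i] @ i # [Suc i..<length a]"
    using upt_add_eq_append[of 0 i "length a - i"] assms by (simp add: upt_conv_Cons)
  then have f: "?f ?c = filter (\<lambda>j. a ! j = ?c) [0..<i] @ i # filter (\<lambda>j. a ! j = ?c) [Suc i..<length a]"
    by simp
  have "filter (\<lambda>j. a ! j = ?c) [0..<i] = filter (\<lambda>j. take i a ! j = ?c) [0..<length (take i a)]"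
    using assms(2) by (intro filter_cong) auto
  then have "length (filter (\<lambda>j. a ! j = ?c) [0..<i]) = count_list (take i a) ?c"
    by (simp only: length_filter_nth_eq)
  then have "rank a i = length (concat (map ?f [0..<?c]) @ filter (\<lambda>j. a ! j = ?c) [0..<i])"
    by (simp only: length_append length_reading_prefix rank_def)
  moreover have "reading_order a = (concat (map ?f [0..<?c]) @ filter (\<lambda>j. a ! j = ?c) [0..<i]) @ i #
      (filter (\<lambda>j. a ! j = ?c) [Suc i..<length a] @ concat (map ?f [Suc ?c..<length a]))"
    by (simp only: r f append_assoc append_Cons)
  ultimately obtain X Y where "rank a i = length X" "reading_order a = X @ i # Y" by blast
  then have "rank a i < length (reading_order a) \<and> reading_order a ! rank a i = i" by simp
  then show "rank a i < length a" "reading_order a ! rank a i = i"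
    by (simp_all add: length_reading_order assms)
qed

lemma rank_reading_order:
  assumes "is_area_vec a" "m < length a"
  shows "rank a (reading_order a ! m) = m"
proof -
  have l: "reading_order a ! m < length a"
    using nth_mem[of m "reading_order a"] assms
    unfolding set_reading_order[OF assms(1)] length_reading_order[OF assms(1)] by simp
  have "reading_order a ! rank a (reading_order a ! m) = reading_order a ! m"
    by (rule reading_order_rank(2)[OF assms(1) l])
  then show ?thesis
    using nth_eq_iff_index_eq[OF distinct_reading_order[OF assms(1)]]
      reading_order_rank(1)[OF assms(1) l] assms by (simp add: length_reading_order)
qed

section \<open>Transport of labelings along the reading order\<close>

definition diag_labels :: "step list \<Rightarrow> nat list \<Rightarrow> nat list" where
  "diag_labels \<mu> P = map ((!) P) (reading_order (heights 0 \<mu>))"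

text \<open>The north-step of row \<open>j\<close> starts on the line \<open>y = x + i\<close>
  exactly when its height is \<open>i\<close>, by \<open>heights_nth\<close>.\<close>

lemma haglund_loehr_eq:
  assumes "\<mu> \<in> dyck_paths n"
  shows "haglund_loehr n (\<mu>, P) = (zmap \<mu>, diag_labels \<mu> P)"
proof -
  have c: "closes 0 \<mu>" "count_list \<mu> N = n" using assms by (auto simp: dyck_paths_iff)
  have "filter (\<lambda>j. j = north_xs \<mu> ! j + i) [0..<n] = filter (\<lambda>j. heights 0 \<mu> ! j = i) [0..<n]" for i
    using heights_nth[OF c(1)] c(2) by (intro filter_cong) force+
  then show ?thesis
    unfolding haglund_loehr_def diag_labels_def reading_order_def
    by (simp add: zeta_eq_zmap[OF assms] c map_concat o_def)
qed

text \<open>The rows of one column are consecutive because \<open>north_xs\<close> is sorted, so it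
  suffices to compare neighbouring rows; these share a column exactly at an ascent of the
  heights.\<close>

lemma vertical_labeling_iff:
  assumes "\<mu> \<in> dyck_paths n"
  shows "vertical_labeling n \<mu> P \<longleftrightarrow> label_list n P \<and>
    (\<forall>i. Suc i < n \<and> heights 0 \<mu> ! Suc i = Suc (heights 0 \<mu> ! i) \<longrightarrow> P ! i < P ! Suc i)"
proof -
  have c: "closes 0 \<mu>" "count_list \<mu> N = n" using assms by (auto simp: dyck_paths_iff)
  have x: "heights 0 \<mu> ! i + north_xs \<mu> ! i = i" if "i < n" for i
    using heights_nth[OF c(1), of i] that c(2) by simp
  have mono: "north_xs \<mu> ! i \<le> north_xs \<mu> ! j" if "i \<le> j" "j < n" for i j
    using sorted_north_xs that c(2) by (simp add: sorted_iff_nth_mono)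
  have eq: "heights 0 \<mu> ! Suc i = Suc (heights 0 \<mu> ! i) \<longleftrightarrow> north_xs \<mu> ! i = north_xs \<mu> ! Suc i"
    if "Suc i < n" for i
    using x[of i] x[of "Suc i"] that by linarith
  have "P ! i < P ! j" if *: "\<forall>i. Suc i < n \<and> north_xs \<mu> ! i = north_xs \<mu> ! Suc i \<longrightarrow> P ! i < P ! Suc i"
    and "Suc i \<le> j" "j < n" "north_xs \<mu> ! i = north_xs \<mu> ! j" for i j
    using that(2-4)
  proof (induction j rule: dec_induct)
    case base
    then show ?case using * by simp
  next
    case (step j)
    have "north_xs \<mu> ! i = north_xs \<mu> ! j" "north_xs \<mu> ! j = north_xs \<mu> ! Suc j"
      using mono[of i j] mono[of j "Suc j"] step by simp_all
    then show ?case using step * by (metis Suc_lessD less_trans)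
  qed
  then show ?thesis unfolding vertical_labeling_def using eq by (auto simp: Suc_le_eq)
qed

lemma label_list_diag_labels:
  assumes "\<mu> \<in> dyck_paths n" "length P = n"
  shows "label_list n (diag_labels \<mu> P) \<longleftrightarrow> label_list n P"
proof -
  let ?o = "reading_order (heights 0 \<mu>)"
  have l: "length ?o = n" and s: "set ?o = {..<n}" and d: "distinct ?o"
    using assms(1) length_reading_order[OF is_area_vec_heights] set_reading_order[OF is_area_vec_heights]
      distinct_reading_order[OF is_area_vec_heights] by (auto simp: dyck_paths_iff)
  have "bij_betw ((!) ?o) {..<n} {..<n}" using d l s by (intro bij_betw_nth) auto
  then have "bij_betw ((!) P) {..<n} {1..n} \<longleftrightarrow> bij_betw ((!) P \<circ> (!) ?o) {..<n} {1..n}"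
    by (rule bij_betw_comp_iff)
  also have "\<dots> \<longleftrightarrow> bij_betw ((!) (diag_labels \<mu> P)) {..<n} {1..n}"
    using l by (intro bij_betw_cong) (simp add: diag_labels_def)
  finally show ?thesis using l assms(2) by (simp add: label_list_def diag_labels_def)
qed

text \<open>The label of row \<open>i\<close> sits at position
  \<open>rank (heights 0 \<mu>) i\<close>. The valleys are given by the ranks of rows
  \<open>i\<close> and \<open>Suc i\<close> at ascents, so both conditions compare the same
  labels.\<close>

lemma diagonal_labeling_zmap_iff:
  assumes "\<mu> \<in> dyck_paths n" "length P = n"
  shows "diagonal_labeling n (zmap \<mu>) (diag_labels \<mu> P) \<longleftrightarrow> vertical_labeling n \<mu> P"
proof -
  let ?a = "heights 0 \<mu>"
  have n: "length ?a = n" using assms(1) by (simp add: dyck_paths_iff)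
  have "diag_labels \<mu> P ! rank ?a i = P ! i" if "i < n" for i
    using reading_order_rank[OF is_area_vec_heights[of \<mu>], of i] that n
    by (simp add: diag_labels_def length_reading_order is_area_vec_heights)
  then have "(\<forall>(x, y) \<in> valleys (zmap \<mu>). diag_labels \<mu> P ! (x - 1) < diag_labels \<mu> P ! y) \<longleftrightarrow>
      (\<forall>i. Suc i < n \<and> ?a ! Suc i = Suc (?a ! i) \<longrightarrow> P ! i < P ! Suc i)"
    unfolding zmap_def valleys_zpath[OF is_area_vec_heights] n by fastforce
  then show ?thesis
    unfolding diagonal_labeling_iff vertical_labeling_iff[OF assms(1)]
    by (simp add: label_list_diag_labels[OF assms])
qed

lemma diag_labels_inj:
  assumes "\<mu> \<in> dyck_paths n" "length P = n" "length P' = n" "diag_labels \<mu> P = diag_labels \<mu> P'"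
  shows "P = P'"
proof (rule nth_equalityI)
  fix i assume i: "i < length P"
  have "set (reading_order (heights 0 \<mu>)) = {..<n}"
    using set_reading_order[OF is_area_vec_heights] assms(1) by (simp add: dyck_paths_iff)
  then show "P ! i = P' ! i" using i assms by (auto simp: diag_labels_def)
qed (use assms in simp)

lemma diag_labels_surj:
  assumes "\<mu> \<in> dyck_paths n" "length Q = n"
  obtains P where "length P = n" "diag_labels \<mu> P = Q"
proof
  let ?a = "heights 0 \<mu>"
  have n: "length ?a = n" using assms(1) by (simp add: dyck_paths_iff)
  have o: "reading_order ?a ! m < n" if "m < n" for m
    using nth_mem[of m "reading_order ?a"] that
    unfolding set_reading_order[OF is_area_vec_heights] length_reading_order[OF is_area_vec_heights] n
    by simp
  \<comment> \<open>The witness gives row \<open>i\<close> the label that \<open>Q\<close> has at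
    the position of this row in the reading order.\<close>
  show "length (map (\<lambda>i. Q ! rank ?a i) [0..<n]) = n" by simp
  show "diag_labels \<mu> (map (\<lambda>i. Q ! rank ?a i) [0..<n]) = Q"
  proof (rule nth_equalityI)
    show "length (diag_labels \<mu> (map (\<lambda>i. Q ! rank ?a i) [0..<n])) = length Q"
      by (simp add: diag_labels_def length_reading_order is_area_vec_heights assms n del: length_heights)
    fix m assume "m < length (diag_labels \<mu> (map (\<lambda>i. Q ! rank ?a i) [0..<n]))"
    then have "m < length ?a"
      by (simp add: diag_labels_def length_reading_order is_area_vec_heights)
    then show "diag_labels \<mu> (map (\<lambda>i. Q ! rank ?a i) [0..<n]) ! m = Q ! m"
      using o n by (simp add: diag_labels_def length_reading_order is_area_vec_heights
          rank_reading_order del: length_heights)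
  qed
qed

text \<open>\<open>Gamma\<close> without trees; the agreement comes from
  \<open>Xi_bounce_eq_gmap\<close>, so that bijectivity can be proved on paths alone.\<close>

definition gmap :: "step list \<times> step list \<times> nat list \<Rightarrow> step list \<times> step list \<times> nat list" where
  "gmap = (\<lambda>(\<mu>, _, P). (bounce_path (zmap \<mu>), zmap \<mu>, diag_labels \<mu> P))"

lemma bij_betw_gmap:
  "bij_betw gmap
     {(\<mu>, steep_path \<mu>, P) | \<mu> P. \<mu> \<in> dyck_paths n \<and> vertical_labeling n \<mu> P}
     {(bounce_path \<nu>, \<nu>, Q) | \<nu> Q. \<nu> \<in> dyck_paths n \<and> diagonal_labeling n \<nu> Q}"
  (is "bij_betw _ ?A ?B")
proof (rule bij_betw_imageI)
  have len: "length P = n" if "vertical_labeling n \<mu> P" for \<mu> P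
    using that by (simp add: vertical_labeling_def label_list_def)
  show "inj_on gmap ?A"
  proof (rule inj_onI)
    fix p p' assume "p \<in> ?A" "p' \<in> ?A" and eq: "gmap p = gmap p'"
    then obtain \<mu> P \<mu>' P' where p: "p = (\<mu>, steep_path \<mu>, P)" "p' = (\<mu>', steep_path \<mu>', P')"
      and m: "\<mu> \<in> dyck_paths n" "\<mu>' \<in> dyck_paths n"
      and v: "vertical_labeling n \<mu> P" "vertical_labeling n \<mu>' P'"
      by blast
    have "\<mu> = \<mu>'" using eq inj_onD[OF inj_on_zmap _ m] by (simp add: p gmap_def)
    moreover have "P = P'"
      using eq diag_labels_inj[OF m(1) len len, OF v] \<open>\<mu> = \<mu>'\<close> by (simp add: p gmap_def)
    ultimately show "p = p'" by (simp add: p)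
  qed
  show "gmap ` ?A = ?B"
  proof (intro equalityI subsetI)
    fix q assume "q \<in> gmap ` ?A"
    then obtain \<mu> P where "q = gmap (\<mu>, steep_path \<mu>, P)" "\<mu> \<in> dyck_paths n" "vertical_labeling n \<mu> P"
      by blast
    then show "q \<in> ?B"
      using bij_betwE[OF bij_betw_zmap] diagonal_labeling_zmap_iff len by (auto simp: gmap_def)
  next
    fix q assume "q \<in> ?B"
    then obtain \<nu> Q where q: "q = (bounce_path \<nu>, \<nu>, Q)" "\<nu> \<in> dyck_paths n" "diagonal_labeling n \<nu> Q"
      by blast
    obtain \<mu> where m: "\<mu> \<in> dyck_paths n" "\<nu> = zmap \<mu>"
      using q(2) bij_betw_imp_surj_on[OF bij_betw_zmap] by blast
    have "length Q = n" using q(3) by (simp add: diagonal_labeling_def label_list_def)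
    then obtain P where P: "length P = n" "diag_labels \<mu> P = Q" by (rule diag_labels_surj[OF m(1)])
    then have "vertical_labeling n \<mu> P" using diagonal_labeling_zmap_iff m q(3) by blast
    then have "(\<mu>, steep_path \<mu>, P) \<in> ?A" using m by blast
    moreover have "q = gmap (\<mu>, steep_path \<mu>, P)" using q m P by (simp add: gmap_def)
    ultimately show "q \<in> gmap ` ?A" by blast
  qed
qed

section \<open>Plane trees and the steep map\<close>

lemma dfs_shift: "dfs (u @ v) t = map (\<lambda>(s, x). (s, u @ x)) (dfs v t)"
proof (induction v t rule: dfs.induct)
  case (1 v ts)
  then show ?case
    by (auto simp: map_concat o_def intro!: arg_cong[where f = concat])
qed

definition word :: "ptree \<Rightarrow> step list" where
  "word t = map fst (dfs [] t)"

text \<open>The non-root nodes in order of discovery, so that the node at position \<open>i\<close>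
  belongs to the north-step of row \<open>i\<close>.\<close>

definition preorder :: "ptree \<Rightarrow> nat list list" where
  "preorder t = map snd (filter (\<lambda>(s, u). s = N) (dfs [] t))"

lemma dfs_singleton: "dfs [i] t = map (\<lambda>(s, x). (s, i # x)) (dfs [] t)"
  using dfs_shift[of "[i]" "[]" t] by simp

lemma word_Node_nth:
  "word (Node ts) = concat (map (\<lambda>i. N # word (ts ! i) @ [E]) (rev [0..<length ts]))"
  by (simp add: word_def dfs_singleton map_concat o_def split_def)

lemma word_Node: "word (Node ts) = concat (map (\<lambda>t. N # word t @ [E]) (rev ts))"
proof -
  have "rev ts = map ((!) ts) (rev [0..<length ts])" by (simp add: map_nth flip: rev_map)
  then have "map (\<lambda>t. N # word t @ [E]) (rev ts) = map (\<lambda>i. N # word (ts ! i) @ [E]) (rev [0..<length ts])"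
    by (simp add: o_def)
  then show ?thesis by (simp only: word_Node_nth)
qed

lemma preorder_Node:
  "preorder (Node ts) =
     concat (map (\<lambda>i. [i] # map (Cons i) (preorder (ts ! i))) (rev [0..<length ts]))"
  by (simp add: preorder_def dfs_singleton filter_concat map_concat filter_map o_def split_def)

text \<open>The walk through a tree returns to the height where it began, so the suffix
  \<open>w\<close> is read from height \<open>h\<close> again. Carrying \<open>w\<close> along makes
  the induction go through.\<close>

lemma heights_word_append:
  "heights h (word t @ w) = map (\<lambda>u. h + length u - 1) (preorder t) @ heights h w"
proof (induction t arbitrary: h w)
  case (Node ts)
  \<comment> \<open>The inner induction runs over an arbitrary list of child indices, later set to
    \<open>rev [0..<length ts]\<close>.\<close>
  have "heights h (concat (map (\<lambda>i. N # word (ts ! i) @ [E]) js) @ w) =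
      map (\<lambda>u. h + length u - 1) (concat (map (\<lambda>i. [i] # map (Cons i) (preorder (ts ! i))) js)) @ heights h w"
    if "set js \<subseteq> {..<length ts}" for js
    using that
  proof (induction js)
    case (Cons i js)
    then have "ts ! i \<in> set ts" by simp
    from Node[OF this] show ?case using Cons by (simp add: o_def)
  qed simp
  from this[of "rev [0..<length ts]"] show ?case by (simp add: word_Node_nth preorder_Node atLeast0LessThan)
qed

lemma closes_word_append: "closes h (word t @ w) \<longleftrightarrow> closes h w"
proof (induction t arbitrary: h w)
  case (Node ts)
  have "closes h (concat (map (\<lambda>t. N # word t @ [E]) us) @ w) \<longleftrightarrow> closes h w"
    if "set us \<subseteq> set ts" for us
    using that by (induction us) (simp_all add: Node)
  then show ?case by (simp add: word_Node)
qed

lemma heights_word: "heights 0 (word t) = map (\<lambda>u. length u - 1) (preorder t)"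
  using heights_word_append[of 0 t "[]"] by simp

lemma word_in_dyck_paths: "word t \<in> dyck_paths (length (preorder t))"
  using closes_word_append[of 0 t "[]"] heights_word[of t]
  by (metis append_Nil2 closes.simps(1) dyck_paths_iff length_heights length_map)

text \<open>A stack automaton reading the word of a tree: the stack holds, for each node on the current
  branch, the list of its children that are already complete.\<close>

fun parse_step :: "step \<Rightarrow> ptree list list \<Rightarrow> ptree list list" where
  "parse_step N S = [] # S"
| "parse_step E (F # G # S) = (Node F # G) # S"
| "parse_step E S = S"

text \<open>Children are completed from right to left and each is put in front of the previous ones,
  which restores their order from left to right.\<close>

lemma fold_parse_word: "fold parse_step (word t) (G # S) = (children t @ G) # S"
proof (induction t arbitrary: G S)
  case (Node ts)
  then show ?case
  proof (induction ts)
    case (Cons t ts)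
    have "fold parse_step (word (Node ts)) (G # S) = (ts @ G) # S"
      using Cons by simp
    moreover have "word (Node (t # ts)) = word (Node ts) @ N # word t @ [E]"
      by (simp add: word_Node)
    ultimately show ?case using Cons.prems[of t "[]"] by (cases t) simp
  qed (simp add: word_Node)
qed

lemma word_inj: "word t = word t' \<Longrightarrow> t = t'"
  using fold_parse_word[of t "[]" "[]"] fold_parse_word[of t' "[]" "[]"] by (simp add: ptree.expand)

text \<open>A word that takes the automaton from \<open>[[]]\<close> to the given nonempty
  stack.\<close>

fun unparse :: "ptree list list \<Rightarrow> step list" where
  "unparse [] = []"
| "unparse [F] = word (Node F)"
| "unparse (F # S) = unparse S @ N # word (Node F)"

text \<open>The letters of \<open>w\<close> are moved into the stack one at a time while
  \<open>unparse S @ w\<close> stays the same. Once \<open>w\<close> is used up,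
  \<open>h = 0\<close> leaves a single forest, the children of the root.\<close>

lemma unparse_complete:
  "closes h w \<Longrightarrow> length S = Suc h \<Longrightarrow> \<exists>t. word t = unparse S @ w"
proof (induction h w arbitrary: S rule: closes.induct)
  case (1 h)
  then obtain F where "S = [F]" by (auto simp: length_Suc_conv)
  then show ?case by auto
next
  case (2 h w)
  then obtain F S' where "S = F # S'" by (cases S) auto
  then have "unparse ([] # S) = unparse S @ [N]" by (simp add: word_Node)
  then show ?case using 2(1)[of "[] # S"] 2 by auto
next
  case (3 h w)
  then obtain F G S' where S: "S = F # G # S'" by (cases S; cases "tl S") auto
  have "word (Node (Node F # G)) = word (Node G) @ N # word (Node F) @ [E]" by (simp add: word_Node)
  then have "unparse ((Node F # G) # S') = unparse S @ [E]" unfolding S by (cases S') simp_all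
  then show ?case using 3(1)[of "(Node F # G) # S'"] 3(2,3) S by auto
qed

lemma word_surj: "\<mu> \<in> dyck_paths n \<Longrightarrow> \<exists>t. word t = \<mu>"
  using unparse_complete[of 0 \<mu> "[[]]"] by (simp add: dyck_paths_iff word_Node)

section \<open>Levels and successors in the preorder\<close>

lemma set_preorder: "set (preorder t) = nonroot t"
proof -
  have "u \<in> set (preorder t) \<longleftrightarrow> u \<noteq> [] \<and> is_node u t" for u
  proof (induction t arbitrary: u)
    case (Node ts)
    show ?case
    proof (cases u)
      case (Cons i v)
      have "u \<in> set (preorder (Node ts)) \<longleftrightarrow> i < length ts \<and> (v = [] \<or> v \<in> set (preorder (ts ! i)))"
        by (auto simp: preorder_Node Cons)
      also have "\<dots> \<longleftrightarrow> i < length ts \<and> is_node v (ts ! i)"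
        using Node[of "ts ! i" v] by (auto intro: nth_mem)
      finally show ?thesis using Cons by simp
    qed (auto simp: preorder_Node)
  qed
  then show ?thesis by (auto simp: nonroot_def nodes_def)
qed

lemma distinct_preorder: "distinct (preorder t)"
proof (induction t)
  case (Node ts)
  have "distinct (concat (map (\<lambda>i. [i] # map (Cons i) (preorder (ts ! i))) js))"
    if "set js \<subseteq> {..<length ts}" "distinct js" for js
    using that
  proof (induction js)
    case (Cons i js)
    have "[] \<notin> set (preorder (ts ! i))" by (simp add: set_preorder nonroot_def)
    moreover have "distinct (preorder (ts ! i))" using Cons Node[of "ts ! i"] by simp
    ultimately show ?case using Cons by (auto simp: distinct_map)
  qed simp
  from this[of "rev [0..<length ts]"] show ?case by (simp add: preorder_Node atLeast0LessThan)
qed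

lemma length_preorder: "length (preorder t) = card (nonroot t)"
  using distinct_card[OF distinct_preorder] by (simp add: set_preorder)

text \<open>Through this identity, levels read from right to left become the diagonals of the path,
  and positions within levels become ranks.\<close>

lemma filter_preorder: "filter (\<lambda>u. length u = Suc k) (preorder t) = rev (level (Suc k) t)"
proof (induction k arbitrary: t)
  case 0
  have "filter (\<lambda>u. length u = Suc 0) ([i] # map (Cons i) (preorder s)) = [[i]]" for i s
    using set_preorder[of s] by (auto simp: filter_map o_def nonroot_def filter_empty_conv)
  then show ?case
    by (cases t) (simp add: preorder_Node filter_concat rev_concat rev_map o_def)
next
  case (Suc k)
  have "filter (\<lambda>u. length u = Suc (Suc k)) ([i] # map (Cons i) (preorder s)) =
      map (Cons i) (rev (level (Suc k) s))" for i s
    using Suc[of s] by (simp add: filter_map o_def del: level.simps)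
  then show ?case
    by (cases t) (simp add: preorder_Node filter_concat rev_concat rev_map o_def level.simps(2)[of "Suc k"] del: level.simps)
qed

lemma leaf_Cons: "leaf t (i # u) \<longleftrightarrow> leaf (children t ! i) u"
  by (simp add: leaf_def)

lemma rightmost_child_Cons: "rightmost_child t (i # u) = i # rightmost_child (children t ! i) u"
  by (simp add: rightmost_child_def)

text \<open>The search goes from a node straight to its rightmost child.\<close>

lemma preorder_nonleaf:
  "u \<in> nonroot t \<Longrightarrow> \<not> leaf t u \<Longrightarrow> \<exists>xs ys. preorder t = xs @ u # rightmost_child t u # ys"
proof (induction t arbitrary: u)
  case (Node ts)
  then obtain i v where u: "u = i # v" "i < length ts" "is_node v (ts ! i)"
    by (cases u) (auto simp: nonroot_def nodes_def)
  have "\<exists>xs ys. [i] # map (Cons i) (preorder (ts ! i)) = xs @ u # rightmost_child (Node ts) u # ys"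
  proof (cases "v = []")
    case True
    obtain us where us: "ts ! i = Node us" by (cases "ts ! i")
    then have "us \<noteq> []" using Node.prems(2) True u by (simp add: leaf_def)
    then obtain m where m: "length us = Suc m" by (cases us) auto
    then obtain zs where "preorder (ts ! i) = [m] # zs" by (simp add: us preorder_Node)
    then show ?thesis using m True u us by (auto simp: rightmost_child_def)
  next
    case False
    then obtain xs ys where "preorder (ts ! i) = xs @ v # rightmost_child (ts ! i) v # ys"
      using Node.IH[of "ts ! i" v] Node.prems(2) u by (auto simp: leaf_Cons nonroot_def nodes_def)
    then have "[i] # map (Cons i) (preorder (ts ! i)) =
        ([i] # map (Cons i) xs) @ u # rightmost_child (Node ts) u # map (Cons i) ys"
      using u by (simp add: rightmost_child_Cons)
    then show ?thesis by blast
  qed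
  moreover have "\<exists>us vs. preorder (Node ts) = us @ ([i] # map (Cons i) (preorder (ts ! i))) @ vs"
  proof -
    have "i \<in> set (rev [0..<length ts])" using u by simp
    then obtain js ks where "rev [0..<length ts] = js @ i # ks" by (meson split_list)
    then show ?thesis unfolding preorder_Node by auto
  qed
  ultimately show ?case by (metis append.assoc append_Cons)
qed

lemma successively_concat:
  assumes "\<And>xs. xs \<in> set xss \<Longrightarrow> xs \<noteq> [] \<and> successively P xs"
    and "\<And>xs ys. xs \<in> set xss \<Longrightarrow> ys \<in> set xss \<Longrightarrow> P (last xs) (hd ys)"
  shows "successively P (concat xss)"
  using assms
proof (induction xss)
  case (Cons xs xss)
  then have "successively P (concat xss)" by simp
  moreover have "P (last xs) (hd (concat xss))" if "concat xss \<noteq> []"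
    using that Cons.prems by (cases xss) auto
  ultimately show ?case using Cons.prems by (auto simp: successively_append_iff)
qed simp

text \<open>After a leaf the search must return before it discovers the next node. Between the walks
  through two children of the root, the next node has depth 1, and no non-root node is
  shallower.\<close>

lemma preorder_leaf:
  "successively (\<lambda>u v. leaf t u \<longrightarrow> length v \<le> length u) (preorder t)"
proof (induction t)
  case (Node ts)
  let ?P = "\<lambda>u v. leaf (Node ts) u \<longrightarrow> length v \<le> length u"
  show ?case unfolding preorder_Node
  proof (rule successively_concat)
    fix xs assume "xs \<in> set (map (\<lambda>i. [i] # map (Cons i) (preorder (ts ! i))) (rev [0..<length ts]))"
    then obtain i where i: "i < length ts" and xs: "xs = [i] # map (Cons i) (preorder (ts ! i))" by auto
    have "\<not> leaf (Node ts) [i]" if "preorder (ts ! i) \<noteq> []"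
      using that by (cases "ts ! i") (auto simp: leaf_def preorder_Node)
    then show "xs \<noteq> [] \<and> successively ?P xs"
      using Node[of "ts ! i"] i unfolding xs by (auto simp: successively_Cons successively_map leaf_Cons)
  next
    fix xs ys
    assume "xs \<in> set (map (\<lambda>i. [i] # map (Cons i) (preorder (ts ! i))) (rev [0..<length ts]))"
      "ys \<in> set (map (\<lambda>i. [i] # map (Cons i) (preorder (ts ! i))) (rev [0..<length ts]))"
    then obtain i j where xs: "xs = [i] # map (Cons i) (preorder (ts ! i))" and "hd ys = [j]" by auto
    moreover have "last xs \<noteq> []" unfolding xs by (auto simp: last_map)
    ultimately show "?P (last xs) (hd ys)" by (cases "last xs") auto
  qed
qed

lemma preorder_successor:
  assumes "i < length (preorder t)"
  shows "\<not> leaf t (preorder t ! i) \<Longrightarrow>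
      Suc i < length (preorder t) \<and> preorder t ! Suc i = rightmost_child t (preorder t ! i)"
    and "\<not> leaf t (preorder t ! i) \<longleftrightarrow>
      Suc i < length (preorder t) \<and> length (preorder t ! Suc i) = Suc (length (preorder t ! i))"
proof -
  let ?p = "preorder t"
  show 1: "Suc i < length ?p \<and> ?p ! Suc i = rightmost_child t (?p ! i)" if nl: "\<not> leaf t (?p ! i)"
  proof -
    have "?p ! i \<in> nonroot t" using assms nth_mem set_preorder by blast
    then obtain xs ys where p: "?p = xs @ ?p ! i # rightmost_child t (?p ! i) # ys"
      using preorder_nonleaf nl by blast
    have l: "length xs < length ?p" by (subst p) simp
    have "?p ! length xs = ?p ! i" by (subst p) simp
    then have "i = length xs" using nth_eq_iff_index_eq[OF distinct_preorder l assms] by simp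
    moreover have "Suc (length xs) < length ?p" by (subst p) simp
    moreover have "?p ! Suc (length xs) = rightmost_child t (?p ! i)" by (subst p) (simp add: nth_append)
    ultimately show ?thesis by simp
  qed
  show "\<not> leaf t (?p ! i) \<longleftrightarrow> Suc i < length ?p \<and> length (?p ! Suc i) = Suc (length (?p ! i))"
  proof
    assume "\<not> leaf t (?p ! i)"
    from 1[OF this] show "Suc i < length ?p \<and> length (?p ! Suc i) = Suc (length (?p ! i))"
      by (simp add: rightmost_child_def)
  next
    assume *: "Suc i < length ?p \<and> length (?p ! Suc i) = Suc (length (?p ! i))"
    then show "\<not> leaf t (?p ! i)"
      using preorder_leaf[of t] by (auto simp: successively_conv_nth)
  qed
qed

lemma preorder_nth_nonempty: "i < length (preorder t) \<Longrightarrow> preorder t ! i \<noteq> []"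
  using nth_mem[of i "preorder t"] set_preorder[of t] by (auto simp: nonroot_def)

lemma heights_word_ascent:
  assumes "i < length (preorder t)"
  shows "Suc i < length (preorder t) \<and> heights 0 (word t) ! Suc i = Suc (heights 0 (word t) ! i)
    \<longleftrightarrow> \<not> leaf t (preorder t ! i)"
proof -
  have "preorder t ! i \<noteq> []" using assms by (rule preorder_nth_nonempty)
  then show ?thesis
    unfolding preorder_successor(2)[OF assms]
    using preorder_nth_nonempty[of "Suc i" t]
    by (cases "preorder t ! i"; cases "preorder t ! Suc i") (auto simp: heights_word)
qed

text \<open>A non-leaf node is followed in the preorder by its rightmost child, and these pairs are
  the ascents of the heights; the tree condition thus becomes the criterion of
  \<open>vertical_labeling_iff\<close>.\<close>

lemma right_increasing_iff:
  assumes "card (nonroot t) = n"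
  shows "right_increasing n t R \<longleftrightarrow>
    R \<in> extensional (nonroot t) \<and> vertical_labeling n (word t) (map R (preorder t))"
proof -
  let ?p = "preorder t"
  have n: "length ?p = n" using assms by (simp add: length_preorder)
  have "bij_betw ((!) ?p) {..<n} (nonroot t)"
    using bij_betw_nth[OF distinct_preorder] n set_preorder by blast
  then have "bij_betw R (nonroot t) {1..n} \<longleftrightarrow> bij_betw (R \<circ> (!) ?p) {..<n} {1..n}"
    by (rule bij_betw_comp_iff)
  also have "\<dots> \<longleftrightarrow> bij_betw ((!) (map R ?p)) {..<n} {1..n}"
    using n by (intro bij_betw_cong) simp
  finally have b: "label_list n (map R ?p) \<longleftrightarrow> bij_betw R (nonroot t) {1..n}"
    using n by (simp add: label_list_def)
  have d: "word t \<in> dyck_paths n" using word_in_dyck_paths[of t] n by simp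
  have "(\<forall>u \<in> nonroot t. \<not> leaf t u \<longrightarrow> R u < R (rightmost_child t u)) \<longleftrightarrow>
      (\<forall>i<n. \<not> leaf t (?p ! i) \<longrightarrow> R (?p ! i) < R (rightmost_child t (?p ! i)))"
    unfolding set_preorder[symmetric] all_set_conv_all_nth n ..
  also have "\<dots> \<longleftrightarrow> (\<forall>i<n. \<not> leaf t (?p ! i) \<longrightarrow> map R ?p ! i < map R ?p ! Suc i)"
    using preorder_successor(1)[of _ t] n by auto
  also have "\<dots> \<longleftrightarrow> (\<forall>i. Suc i < n \<and> heights 0 (word t) ! Suc i = Suc (heights 0 (word t) ! i) \<longrightarrow>
      map R ?p ! i < map R ?p ! Suc i)"
    using heights_word_ascent[of _ t] unfolding n by (meson Suc_lessD)
  finally show ?thesis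
    unfolding right_increasing_def vertical_labeling_iff[OF d] b by blast
qed

section \<open>Bijectivity of the steep map\<close>

lemma Xi_steep_eq: "Xi_steep (t, \<alpha>, R) = (word t, steep_path (word t), map R (preorder t))"
  by (simp add: Xi_steep_def word_def preorder_def Let_def split_def)

lemma bij_betw_Xi_steep:
  "bij_betw Xi_steep (LAC n)
     {(\<mu>, steep_path \<mu>, P) | \<mu> P. \<mu> \<in> dyck_paths n \<and> vertical_labeling n \<mu> P}"
  (is "bij_betw _ _ ?A")
proof (rule bij_betw_imageI)
  show "inj_on Xi_steep (LAC n)"
  proof (rule inj_onI)
    fix x x' assume "x \<in> LAC n" "x' \<in> LAC n" and eq: "Xi_steep x = Xi_steep x'"
    then obtain t R t' R' where x: "x = (t, alpha t, R)" "x' = (t', alpha t', R')"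
      and R: "R \<in> extensional (nonroot t)" "R' \<in> extensional (nonroot t')"
      unfolding LAC_def right_increasing_def by blast
    have t: "t = t'" using eq word_inj by (simp add: x Xi_steep_eq)
    \<comment> \<open>The label list fixes the labeling on the non-root nodes, and extensionality
      fixes it elsewhere.\<close>
    have "R u = R' u" if "u \<in> nonroot t" for u
      using eq that by (auto simp: x t Xi_steep_eq set_preorder)
    then have "R = R'" using R t by (auto intro: extensionalityI)
    then show "x = x'" using x t by simp
  qed
  show "Xi_steep ` LAC n = ?A"
  proof (intro equalityI subsetI)
    fix y assume "y \<in> Xi_steep ` LAC n"
    then obtain t R where y: "y = Xi_steep (t, alpha t, R)" and c: "card (nonroot t) = n"
      and "right_increasing n t R"
      unfolding LAC_def by blast
    then have "vertical_labeling n (word t) (map R (preorder t))" by (simp add: right_increasing_iff)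
    moreover have "word t \<in> dyck_paths n" using word_in_dyck_paths[of t] c by (simp add: length_preorder)
    ultimately show "y \<in> ?A" unfolding y Xi_steep_eq by blast
  next
    fix y assume "y \<in> ?A"
    then obtain \<mu> P where y: "y = (\<mu>, steep_path \<mu>, P)" "\<mu> \<in> dyck_paths n" "vertical_labeling n \<mu> P"
      by blast
    obtain t where t: "word t = \<mu>" using word_surj y(2) by blast
    have n: "length (preorder t) = n" using y(2) word_in_dyck_paths[of t] by (simp add: t dyck_paths_iff)
    have "length P = n" using y(3) by (simp add: vertical_labeling_def label_list_def)
    \<comment> \<open>Each node gets the label at its position in the preorder;
      \<open>restrict\<close> makes the function extensional, as \<open>right_increasing\<close>
      demands.\<close>
    define R where "R = restrict (the \<circ> map_of (zip (preorder t) P)) (nonroot t)"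
    have "map R (preorder t) = P"
    proof (rule nth_equalityI)
      fix i assume "i < length (map R (preorder t))"
      then have i: "i < length (preorder t)" by simp
      then have "preorder t ! i \<in> nonroot t" using set_preorder nth_mem by blast
      then show "map R (preorder t) ! i = P ! i"
        using i n \<open>length P = n\<close> by (simp add: R_def map_of_zip_nth distinct_preorder)
    qed (use n \<open>length P = n\<close> in simp)
    moreover have c: "card (nonroot t) = n" using n by (simp add: length_preorder)
    moreover have "R \<in> extensional (nonroot t)" by (simp add: R_def)
    ultimately have "right_increasing n t R" using y(3) t by (simp add: right_increasing_iff)
    then have "(t, alpha t, R) \<in> LAC n" using c unfolding LAC_def by blast
    moreover have "y = Xi_steep (t, alpha t, R)"
      using y(1) t \<open>map R (preorder t) = P\<close> by (simp add: Xi_steep_eq)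
    ultimately show "y \<in> Xi_steep ` LAC n" by blast
  qed
qed

section \<open>Plane trees and the bounce map\<close>

lemma length_filter_depth:
  "[] \<notin> set p \<Longrightarrow>
    length (filter (\<lambda>u. length u = Suc k) p) = count_list (map (\<lambda>u. length u - 1) p) k"
proof (induction p)
  case (Cons u p)
  then show ?case by (cases u) auto
qed simp

lemma Nil_notin_preorder: "[] \<notin> set (preorder t)"
  by (simp add: set_preorder nonroot_def)

lemma length_filter_preorder:
  "length (filter (\<lambda>u. length u = Suc k) (preorder t)) = count_list (heights 0 (word t)) k"
  by (simp add: length_filter_depth Nil_notin_preorder heights_word)

lemma finite_nodes: "finite (nodes t)"
proof -
  have "nodes t = insert [] (set (preorder t))" by (auto simp: set_preorder nonroot_def nodes_def)
  then show ?thesis by simp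
qed

lemma length_le_height: "u \<in> nodes t \<Longrightarrow> length u \<le> length (alpha t)"
  using finite_nodes by (simp add: alpha_def del: upt_Suc)

text \<open>Nodes at depth \<open>Suc k\<close> correspond to rows of height \<open>k\<close>, so
  the level sizes are the multiplicities in the area vector.\<close>

lemma alpha_eq: "alpha t = map (count_list (heights 0 (word t))) [0..<length (alpha t)]"
proof -
  have "card {u \<in> nodes t. length u = Suc k} = count_list (heights 0 (word t)) k" for k
  proof -
    have "{u \<in> nodes t. length u = Suc k} = set (filter (\<lambda>u. length u = Suc k) (preorder t))"
      by (auto simp: set_preorder nonroot_def)
    then show ?thesis
      using distinct_card[OF distinct_filter[OF distinct_preorder]] length_filter_preorder by metis
  qed
  then have "alpha t = map (\<lambda>i. count_list (heights 0 (word t)) (i - 1)) [Suc 0..<Suc (Max (length ` nodes t))]"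
    unfolding alpha_def by (intro map_cong) (auto simp: Suc_le_eq gr0_conv_Suc)
  then show ?thesis by (simp add: o_def flip: map_Suc_upt del: upt_Suc)
qed

text \<open>The sums \<open>s_k\<close> in the marked points are thereby matched with the bounce
  parameters.\<close>

lemma sum_list_take_alpha:
  assumes "k \<le> length (alpha t)"
  shows "sum_list (take k (alpha t)) = below (heights 0 (word t)) k"
proof -
  have "sum_list (map (count_list a) [0..<k]) = below a k" for a
    by (induction k) (auto simp: below_Suc)
  then show ?thesis using assms by (subst alpha_eq) (simp add: take_map)
qed

lemma level_length: "u \<in> set (level k t) \<Longrightarrow> length u = k"
  by (induction k arbitrary: t u) auto

text \<open>On each level the preorder runs from right to left, so
  \<open>count_list (take m a) (a ! m)\<close> is the number of nodes to the right of node
  \<open>m\<close> on its level.\<close>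

lemma nth_from_left_iff:
  assumes "m < length (preorder t)"
  defines "a \<equiv> heights 0 (word t)"
  shows "nth_from_left t k i (preorder t ! m) \<longleftrightarrow>
    k = Suc (a ! m) \<and> i + count_list (take m a) (a ! m) = count_list a (a ! m) \<and> 1 \<le> i"
proof -
  let ?p = "preorder t" and ?u = "preorder t ! m"
  have am: "length ?u = Suc (a ! m)"
    using preorder_nth_nonempty[OF assms(1)] assms(1) by (simp add: a_def heights_word)
  have "nth_from_left t (Suc (a ! m)) i ?u \<longleftrightarrow>
      i + count_list (take m a) (a ! m) = count_list a (a ! m) \<and> 1 \<le> i"
  proof -
    define Q :: "nat list \<Rightarrow> bool" where "Q = (\<lambda>u. length u = Suc (a ! m))"
    define F where "F = filter Q ?p"
    have len: "length F = count_list a (a ! m)"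
      unfolding F_def Q_def a_def by (rule length_filter_preorder)
    define X where "X = filter Q (take m ?p)"
    have F: "F = X @ ?u # filter Q (drop (Suc m) ?p)"
      using am unfolding F_def X_def
      by (subst id_take_nth_drop[OF assms(1)]) (simp add: Q_def)
    have lX: "length X = count_list (take m a) (a ! m)"
    proof -
      have "[] \<notin> set (take m ?p)" using Nil_notin_preorder[of t] by (auto dest: in_set_takeD)
      then show ?thesis
        unfolding X_def Q_def by (simp add: length_filter_depth a_def heights_word take_map)
    qed
    have lev: "level (Suc (a ! m)) t = rev F"
      unfolding F_def Q_def filter_preorder by simp
    have dF: "distinct F" unfolding F_def by (intro distinct_filter distinct_preorder)
    have lt: "length X < length F" and nX: "F ! length X = ?u" unfolding F by simp_all
    have "nth_from_left t (Suc (a ! m)) i ?u \<longleftrightarrow> 1 \<le> i \<and> i \<le> length F \<and> F ! (length F - i) = F ! length X"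
      unfolding nth_from_left_def lev nX by (auto simp: rev_nth)
    also have "\<dots> \<longleftrightarrow> 1 \<le> i \<and> i \<le> length F \<and> length F - i = length X"
      using nth_eq_iff_index_eq[OF dF _ lt, of "length F - i"] lt by fastforce
    also have "\<dots> \<longleftrightarrow> i + length X = length F \<and> 1 \<le> i" by auto
    finally show ?thesis by (simp only: lX len)
  qed
  moreover have "k = Suc (a ! m)" if "nth_from_left t k i ?u"
  proof -
    have "i - 1 < length (level k t)" "level k t ! (i - 1) = ?u"
      using that by (auto simp: nth_from_left_def)
    then have "?u \<in> set (level k t)" by (metis nth_mem)
    then show ?thesis using level_length am by fastforce
  qed
  ultimately show ?thesis by blast
qed

section \<open>The marked points are the valleys of \<open>zmap (word t)\<close>\<close>

lemma marked_points_eq_valleys: "marked_points t (alpha t) = valleys (zmap (word t))"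
proof -
  let ?p = "preorder t"
  define a where "a = heights 0 (word t)"
  have la: "length a = length ?p" by (simp add: a_def heights_word)
  \<comment> \<open>Subtracting a position counted from the left from the level size leaves the
    number of nodes further right, the second summand of \<open>rank\<close>. As \<open>s\<close> is
    \<open>below a (Suc (a ! m))\<close>, the level size is part of \<open>s\<close> in the first
    coordinate and is \<open>alpha t ! k\<close> in the second.\<close>
  have key: "(s - i + 1, s + alpha t ! k - j) = (Suc (rank a m), rank a (Suc m))"
    if m: "m < length ?p" "\<not> leaf t (?p ! m)" and s: "s = sum_list (take k (alpha t))"
      and i: "nth_from_left t k i (?p ! m)"
      and j: "nth_from_left t (Suc k) j (rightmost_child t (?p ! m))" for s k i j m
  proof -
    have sm: "Suc m < length ?p" "rightmost_child t (?p ! m) = ?p ! Suc m"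
      using preorder_successor(1)[OF m] by simp_all
    have asc: "a ! Suc m = Suc (a ! m)" using heights_word_ascent[OF m(1)] m(2) by (simp add: a_def)
    have k: "k = Suc (a ! m)" and i': "i + count_list (take m a) (a ! m) = count_list a (a ! m)" "1 \<le> i"
      using i nth_from_left_iff[OF m(1)] by (auto simp: a_def)
    have j': "j + count_list (take (Suc m) a) k = count_list a k"
      using j nth_from_left_iff[OF sm(1)] asc k by (auto simp: a_def sm(2))
    \<comment> \<open>The child at depth \<open>Suc k\<close> shows that the index \<open>k\<close>
      is within \<open>alpha t\<close>.\<close>
    have "?p ! Suc m \<in> nodes t"
      using sm(1) set_preorder[of t] nth_mem by (auto simp: nonroot_def)
    then have "length (?p ! Suc m) \<le> length (alpha t)" by (rule length_le_height)
    moreover have "length (?p ! Suc m) = Suc (a ! Suc m)"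
      using preorder_nth_nonempty[OF sm(1)] sm(1) by (simp add: a_def heights_word)
    ultimately have kl: "k < length (alpha t)" using asc k by simp
    then have "alpha t ! k = count_list a k"
      by (subst alpha_eq) (simp add: a_def)
    moreover have "s = below a (a ! m) + count_list a (a ! m)"
      using s sum_list_take_alpha[of k t] kl k by (simp add: a_def below_Suc)
    ultimately show ?thesis
      using i' j' unfolding rank_def asc k below_Suc by simp arith
  qed
  have "marked_points t (alpha t) =
    {(Suc (rank a m), rank a (Suc m)) | m. m < length ?p \<and> \<not> leaf t (?p ! m)}" (is "_ = ?B")
  proof (intro equalityI subsetI)
    fix q assume "q \<in> marked_points t (alpha t)"
    then obtain s k i j u where q: "q = (s - i + 1, s + alpha t ! k - j)" "u \<in> nonroot t" "\<not> leaf t u"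
      "s = sum_list (take k (alpha t))" "nth_from_left t k i u" "nth_from_left t (Suc k) j (rightmost_child t u)"
      unfolding marked_points_def by blast
    then obtain m where m: "m < length ?p" "u = ?p ! m" by (metis in_set_conv_nth set_preorder)
    have "q = (Suc (rank a m), rank a (Suc m))"
      unfolding q(1) using q(3-6) unfolding m(2) by (rule key[OF m(1)])
    then show "q \<in> ?B" using m q by blast
  next
    fix q assume "q \<in> ?B"
    then obtain m where q: "q = (Suc (rank a m), rank a (Suc m))" and m: "m < length ?p" "\<not> leaf t (?p ! m)"
      by blast
    have sm: "Suc m < length ?p" "rightmost_child t (?p ! m) = ?p ! Suc m"
      using preorder_successor(1)[OF m] by simp_all
    have asc: "a ! Suc m = Suc (a ! m)" using heights_word_ascent[OF m(1)] m(2) by (simp add: a_def)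
    \<comment> \<open>The entry at \<open>m\<close> is left out of \<open>take m a\<close>; hence
      the position chosen below is at least 1, as \<open>nth_from_left\<close> demands.\<close>
    have c: "count_list (take m a) (a ! m) < count_list a (a ! m)" if "m < length a" for m
      using that arg_cong[OF id_take_nth_drop[OF that], of "\<lambda>b. count_list b (a ! m)"] by simp
    obtain i where i: "nth_from_left t (Suc (a ! m)) i (?p ! m)"
      using c[of m] m la nth_from_left_iff[OF m(1), of "Suc (a ! m)" "count_list a (a ! m) - count_list (take m a) (a ! m)"]
      by (auto simp: a_def)
    obtain j where j: "nth_from_left t (Suc (Suc (a ! m))) j (?p ! Suc m)"
      using c[of "Suc m"] sm la asc nth_from_left_iff[OF sm(1), of "Suc (Suc (a ! m))"
          "count_list a (a ! Suc m) - count_list (take (Suc m) a) (a ! Suc m)"]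
      by (auto simp: a_def)
    have u: "?p ! m \<in> nonroot t" using m(1) nth_mem set_preorder by blast
    show "q \<in> marked_points t (alpha t)"
      unfolding q key[OF m refl i j[folded sm(2)], symmetric] marked_points_def
      by (intro CollectI exI conjI) (rule refl u m(2) i j[folded sm(2)])+
  qed
  moreover have "m < length ?p \<and> \<not> leaf t (?p ! m) \<longleftrightarrow> Suc m < length a \<and> a ! Suc m = Suc (a ! m)" for m
    using heights_word_ascent[of m t, folded a_def] by (auto simp: la)
  ultimately show ?thesis
    unfolding zmap_def a_def valleys_zpath[OF is_area_vec_heights] by simp
qed

section \<open>Diagonal labels read level by level\<close>

lemma concat_map_upt_extend:
  "m \<le> m' \<Longrightarrow> (\<And>i. m \<le> i \<Longrightarrow> f i = []) \<Longrightarrow> concat (map f [0..<m']) = concat (map f [0..<m])"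
  by (induction rule: dec_induct) simp_all

lemma level_labels_eq:
  "concat (map (\<lambda>k. map R (rev (level k t))) [1..<Suc (length (alpha t))]) =
   diag_labels (word t) (map R (preorder t))"
proof -
  let ?p = "preorder t"
  define a where "a = heights 0 (word t)"
  have la: "length a = length ?p" by (simp add: a_def heights_word)
  define f where "f j = map R (filter (\<lambda>u. length u = Suc j) ?p)" for j
  have "map R (rev (level (Suc j) t)) = f j" for j
    by (simp add: f_def filter_preorder)
  then have "concat (map (\<lambda>k. map R (rev (level k t))) [1..<Suc (length (alpha t))]) =
      concat (map f [0..<length (alpha t)])"
    by (simp add: o_def flip: map_Suc_upt del: upt_Suc level.simps)
  \<comment> \<open>The tree is read up to its height, the area vector up to its length. Levels past
    either bound are empty, so both ranges extend to their sum and the bounds need not be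
    compared.\<close>
  also have "\<dots> = concat (map f [0..<length (alpha t) + length a])"
  proof (rule concat_map_upt_extend[OF le_add1, symmetric])
    fix j assume "length (alpha t) \<le> j"
    then show "f j = []"
      using length_le_height[of _ t] set_preorder[of t]
      by (fastforce simp: f_def filter_empty_conv nonroot_def)
  qed
  also have "\<dots> = concat (map f [0..<length a])"
  proof (rule concat_map_upt_extend[OF le_add2])
    fix j assume "length a \<le> j"
    then have "j \<notin> set a" using area_vec_less[OF is_area_vec_heights] unfolding a_def by force
    then have "length (f j) = 0"
      by (simp add: f_def length_filter_preorder a_def del: length_0_conv)
    then show "f j = []" by simp
  qed
  also have "\<dots> = concat (map (\<lambda>j. map ((!) (map R ?p)) (filter (\<lambda>i. a ! i = j) [0..<length a])) [0..<length a])"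
  proof -
    have "map ((!) (map R ?p)) (filter (\<lambda>i. a ! i = j) [0..<length a]) = f j" for j
    proof -
      have "filter (\<lambda>i. a ! i = j) [0..<length a] = filter (\<lambda>i. length (?p ! i) = Suc j) [0..<length ?p]"
        using preorder_nth_nonempty[of _ t] unfolding la
        by (intro filter_cong) (auto simp: a_def heights_word)
      moreover have "map ((!) (map R ?p)) (filter (\<lambda>i. length (?p ! i) = Suc j) [0..<length ?p]) =
          map R (map ((!) ?p) (filter (\<lambda>i. length (?p ! i) = Suc j) [0..<length ?p]))"
        by auto
      ultimately show ?thesis
        using map_nth_filter[of ?p "\<lambda>u. length u = Suc j"] by (simp only: f_def)
    qed
    then show ?thesis by simp
  qed
  also have "\<dots> = diag_labels (word t) (map R ?p)"
    unfolding diag_labels_def reading_order_def a_def[symmetric] by (simp add: map_concat o_def)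
  finally show ?thesis .
qed

section \<open>The two tree maps combined\<close>

lemma Xi_bounce_eq_gmap:
  assumes "x \<in> LAC n"
  shows "Xi_bounce n x = gmap (Xi_steep x)"
proof -
  obtain t R where x: "x = (t, alpha t, R)" and "card (nonroot t) = n"
    using assms unfolding LAC_def by blast
  then have "word t \<in> dyck_paths n" using word_in_dyck_paths[of t] by (simp add: length_preorder)
  then have z: "zmap (word t) \<in> dyck_paths n" by (rule bij_betwE[OF bij_betw_zmap, rule_format])
  have "(THE \<nu>. \<nu> \<in> dyck_paths n \<and> valleys \<nu> = marked_points t (alpha t)) = zmap (word t)"
  proof (rule the_equality)
    fix \<nu> assume "\<nu> \<in> dyck_paths n \<and> valleys \<nu> = marked_points t (alpha t)"
    then show "\<nu> = zmap (word t)"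
      using z by (intro valleys_inj) (auto simp: marked_points_eq_valleys dyck_paths_def pt_def)
  qed (use z in \<open>simp add: marked_points_eq_valleys\<close>)
  then show ?thesis
    unfolding x Xi_bounce_def Xi_steep_eq gmap_def Let_def by (simp only: case_prod_conv level_labels_eq)
qed

theorem corollary3p22:
  fixes n :: nat
  assumes "n > 0"
  shows "bij_betw (Gamma n)
           {(\<mu>, steep_path \<mu>, P) | \<mu> P. \<mu> \<in> dyck_paths n \<and> vertical_labeling n \<mu> P}
           {(bounce_path \<nu>, \<nu>, Q) | \<nu> Q. \<nu> \<in> dyck_paths n \<and> diagonal_labeling n \<nu> Q} \<and>
         (\<forall>\<mu> P \<nu> Q. \<mu> \<in> dyck_paths n \<and> vertical_labeling n \<mu> P \<and>
            (bounce_path \<nu>, \<nu>, Q) = Gamma n (\<mu>, steep_path \<mu>, P) \<longrightarrow>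
            (\<nu>, Q) = haglund_loehr n (\<mu>, P))"
proof -
  let ?A = "{(\<mu>, steep_path \<mu>, P) | \<mu> P. \<mu> \<in> dyck_paths n \<and> vertical_labeling n \<mu> P}"
  \<comment> \<open>\<open>inv_into\<close> yields a labeled tree that \<open>Xi_steep\<close> sends
    to \<open>y\<close>; there \<open>Xi_bounce\<close> is \<open>gmap\<close> after
    \<open>Xi_steep\<close>, so the tree drops out.\<close>
  have G: "Gamma n y = gmap y" if "y \<in> ?A" for y
  proof -
    have y: "y \<in> Xi_steep ` LAC n" using that bij_betw_imp_surj_on[OF bij_betw_Xi_steep] by simp
    show ?thesis
      using Xi_bounce_eq_gmap[OF inv_into_into[OF y]] f_inv_into_f[OF y] by (simp add: Gamma_def)
  qed
  show ?thesis
  proof (intro conjI allI impI)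
    show "bij_betw (Gamma n) ?A
        {(bounce_path \<nu>, \<nu>, Q) | \<nu> Q. \<nu> \<in> dyck_paths n \<and> diagonal_labeling n \<nu> Q}"
      by (subst bij_betw_cong[OF G]) (assumption, rule bij_betw_gmap)
  next
    fix \<mu> P \<nu> Q
    assume *: "\<mu> \<in> dyck_paths n \<and> vertical_labeling n \<mu> P \<and>
      (bounce_path \<nu>, \<nu>, Q) = Gamma n (\<mu>, steep_path \<mu>, P)"
    then have "(\<mu>, steep_path \<mu>, P) \<in> ?A" by blast
    from G[OF this] show "(\<nu>, Q) = haglund_loehr n (\<mu>, P)"
      using * by (simp add: gmap_def haglund_loehr_eq)
  qed
qed

end
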